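(* Let $\mathcal{G}=(V,E)$ be a finite connected undirected graph with conductances $c:E\to\mathbb{R}_{>0}$ and a marked vertex $b\in V$, and let $z_0\in V$ with $z_0\neq b$. Let $\Sigma$ be the floating component of a $\mathbb{P}$-random two-component spanning forest of $\mathcal{G}$, and $|\Sigma|$ its number of vertices. Then the conditional expected size of $\Sigma$ given that it contains $z_0$ satisfies $$\mathbb{E}\left(|\Sigma|\;\middle|\;z_0\in\Sigma\right)=\sum_{v}\frac{G_{v,z_0}}{G_{z_0,z_0}}=\frac{\mathbb{E}(\tau_D^{z_0})}{G_{z_0,z_0}},$$ where the sum is over the vertices $v\in V$ and $\tau_D^{z_0}$ is the exit time of a conductance-biased random walk started at $z_0$.
   Context: A two-component spanning forest (2SF) of $\mathcal{G}$ is a subgraph $(V,B)$, $B\subseteq E$, which contains no cycles and has exactly two connected components. The weight of a subgraph is the product of the conductances $c(e)$ of its edges. $\mathbb{P}$ (with expectation $\mathbb{E}$) is the probability measure on 2SFs assigning to each 2SF a probability proportional to its weight. The floating component of a 2SF is the component not containing $b$. The Laplacian is $\Delta f(v)=\sum_{v'\sim v}c_{vv'}(f(v)-f(v'))$ on $\mathbb{R}^V$, the sum being over the neighbors of $v$. The Dirichlet Laplacian $\Delta_D$ on $\mathbb{R}^{V\setminus\{b\}}$ is the matrix obtained from $\Delta$ by removing the row and column of $b$; it is invertible. $G=\Delta_D^{-1}$ is the Green's function with Dirichlet boundary conditions at $b$ (so $G_{u,v}=0$ if $u=b$ or $v=b$). $G_{u,v}$ is interpreted as the expected number of visits to $v$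 of a conductance-biased random walk from $u$ to $b$. The conductance-biased random walk is the walk which moves from a vertex to a neighbor with probability proportional to the conductance of the connecting edge; its exit time is the time at which it first reaches the boundary vertex $b$.
   Formalization: The random walk is taken in continuous time: it stays at each vertex v an exponential time whose rate is the total conductance at v. With unit time steps the second equality fails (e.g. a single edge of conductance c ≠ 1). *)

theory Defs
  imports "HOL-Probability.Probability"
begin

text \<open>Finite undirected graphs are pairs of a vertex set and a set of two-element edges,
  so loops and multiple edges are excluded; conductances are functions on edges.\<close>

definition simple_graph :: "'a set \<Rightarrow> 'a set set \<Rightarrow> bool" where
  "simple_graph V E \<longleftrightarrow> finite V \<and> (\<forall>e\<in>E. e \<subseteq> V \<and> card e = 2)"

definition graph_component :: "'a set \<Rightarrow> 'a set set \<Rightarrow> 'a \<Rightarrow> 'a set" where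
  "graph_component V B v = {w \<in> V. (\<lambda>x y. {x, y} \<in> B)\<^sup>*\<^sup>* v w}"

definition graph_components :: "'a set \<Rightarrow> 'a set set \<Rightarrow> 'a set set" where
  "graph_components V B = graph_component V B ` V"

definition connected_graph :: "'a set \<Rightarrow> 'a set set \<Rightarrow> bool" where
  "connected_graph V E \<longleftrightarrow> card (graph_components V E) = 1"

text \<open>A cycle is given by the list of its vertices; the last vertex is joined to the first.\<close>

definition is_cycle :: "'a set set \<Rightarrow> 'a list \<Rightarrow> bool" where
  "is_cycle B xs \<longleftrightarrow> 3 \<le> length xs \<and> distinct xs \<and>
     (\<forall>i < length xs. {xs ! i, xs ! (Suc i mod length xs)} \<in> B)"


subsection \<open>Random two-component spanning forests\<close>

definition two_forests :: "'a set \<Rightarrow> 'a set set \<Rightarrow> 'a set set set" where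
  "two_forests V E =
     {B. B \<subseteq> E \<and> (\<nexists>xs. is_cycle B xs) \<and> card (graph_components V B) = 2}"

definition weight :: "('a set \<Rightarrow> real) \<Rightarrow> 'a set set \<Rightarrow> real" where
  "weight c B = (\<Prod>e\<in>B. c e)"

definition two_forest_pmf :: "'a set \<Rightarrow> 'a set set \<Rightarrow> ('a set \<Rightarrow> real) \<Rightarrow> 'a set set pmf" where
  "two_forest_pmf V E c =
     embed_pmf (\<lambda>B. if B \<in> two_forests V E
                      then weight c B / (\<Sum>B'\<in>two_forests V E. weight c B') else 0)"

definition floating :: "'a set \<Rightarrow> 'a \<Rightarrow> 'a set set \<Rightarrow> 'a set" where
  "floating V b B = (THE C. C \<in> graph_components V B \<and> b \<notin> C)"

definition cond_floating_size ::
  "'a set \<Rightarrow> 'a set set \<Rightarrow> ('a set \<Rightarrow> real) \<Rightarrow> 'a \<Rightarrow> 'a \<Rightarrow> real" where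
  "cond_floating_size V E c b z =
     measure_pmf.expectation (cond_pmf (two_forest_pmf V E c) {B. z \<in> floating V b B})
       (\<lambda>B. real (card (floating V b B)))"


subsection \<open>Laplacian and Green's function\<close>

definition neighbors :: "'a set set \<Rightarrow> 'a \<Rightarrow> 'a set" where
  "neighbors E v = {w. {v, w} \<in> E}"

definition laplacian :: "'a set set \<Rightarrow> ('a set \<Rightarrow> real) \<Rightarrow> ('a \<Rightarrow> real) \<Rightarrow> 'a \<Rightarrow> real" where
  "laplacian E c f v = (\<Sum>w\<in>neighbors E v. c {v, w} * (f v - f w))"

definition laplacian_matrix :: "'a set set \<Rightarrow> ('a set \<Rightarrow> real) \<Rightarrow> 'a \<Rightarrow> 'a \<Rightarrow> real" where
  "laplacian_matrix E c u v = laplacian E c (indicator {v}) u"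

text \<open>The inverse of the square matrix \<open>(A u v)\<close> with rows and columns indexed by the finite
  set \<open>S\<close>, extended by zero outside \<open>S \<times> S\<close>.\<close>

definition inverse_matrix_on :: "'a set \<Rightarrow> ('a \<Rightarrow> 'a \<Rightarrow> real) \<Rightarrow> 'a \<Rightarrow> 'a \<Rightarrow> real" where
  "inverse_matrix_on S A =
     (THE B. (\<forall>u\<in>S. \<forall>v\<in>S. (\<Sum>w\<in>S. A u w * B w v) = of_bool (u = v)) \<and>
             (\<forall>u\<in>S. \<forall>v\<in>S. (\<Sum>w\<in>S. B u w * A w v) = of_bool (u = v)) \<and>
             (\<forall>u v. \<not> (u \<in> S \<and> v \<in> S) \<longrightarrow> B u v = 0))"

text \<open>Removing the row and column of \<open>b\<close> amounts to restricting the index set.\<close>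

definition green :: "'a set \<Rightarrow> 'a set set \<Rightarrow> ('a set \<Rightarrow> real) \<Rightarrow> 'a \<Rightarrow> 'a \<Rightarrow> 'a \<Rightarrow> real" where
  "green V E c b = inverse_matrix_on (V - {b}) (laplacian_matrix E c)"


subsection \<open>Conductance-biased random walk and its exit time\<close>

definition total_conductance :: "'a set set \<Rightarrow> ('a set \<Rightarrow> real) \<Rightarrow> 'a \<Rightarrow> real" where
  "total_conductance E c v = (\<Sum>w\<in>neighbors E v. c {v, w})"

definition step_prob :: "'a set set \<Rightarrow> ('a set \<Rightarrow> real) \<Rightarrow> 'a \<Rightarrow> 'a \<Rightarrow> real" where
  "step_prob E c v w =
     (if w \<in> neighbors E v then c {v, w} / total_conductance E c v else 0)"

text \<open>The clock of the walk is the one for which \<open>G\<^bsub>u,v\<^esub>\<close>, the inverse of the unnormalized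
  Laplacian, is the expected occupation time of \<open>v\<close>: the walk crosses each edge \<open>e\<close> at rate
  \<open>c e\<close>, so that a visit to \<open>v\<close> lasts an exponential time of rate \<open>total_conductance E c v\<close>.
  (With unit time steps the expected number of visits to \<open>v\<close> would instead be
  \<open>G\<^bsub>u,v\<^esub> * total_conductance E c v\<close>.)

  \<open>X n\<close> is the position after \<open>n\<close> jumps and \<open>H n\<close> the holding time there. The displayed law
  says that \<open>X\<close> is the Markov chain with transition probabilities \<open>step_prob E c\<close> started at
  \<open>z\<close> and that, given \<open>X\<close>, the \<open>H n\<close> are independent exponential variables of rates
  \<open>total_conductance E c (X n)\<close>.\<close>

definition conductance_walk ::
  "'a set set \<Rightarrow> ('a set \<Rightarrow> real) \<Rightarrow> 'a \<Rightarrow> 'w measure \<Rightarrow> (nat \<Rightarrow> 'w \<Rightarrow> 'a) \<Rightarrow>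
     (nat \<Rightarrow> 'w \<Rightarrow> real) \<Rightarrow> bool" where
  "conductance_walk E c z M X H \<longleftrightarrow>
     prob_space M \<and>
     (\<forall>n. X n \<in> measurable M (count_space UNIV)) \<and>
     (\<forall>n. H n \<in> borel_measurable M) \<and>
     (\<forall>n x t. (\<forall>i\<le>n. 0 \<le> t i) \<longrightarrow>
        measure M {\<omega> \<in> space M. \<forall>i\<le>n. X i \<omega> = x i \<and> t i < H i \<omega>} =
          of_bool (x 0 = z) * (\<Prod>i<n. step_prob E c (x i) (x (Suc i))) *
          (\<Prod>i\<le>n. exp (- total_conductance E c (x i) * t i)))"

definition exit_time :: "'a \<Rightarrow> (nat \<Rightarrow> 'w \<Rightarrow> 'a) \<Rightarrow> (nat \<Rightarrow> 'w \<Rightarrow> real) \<Rightarrow> 'w \<Rightarrow> ennreal" where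
  "exit_time b X H \<omega> =
     (if \<exists>n. X n \<omega> = b then ennreal (\<Sum>i<(LEAST n. X n \<omega> = b). H i \<omega>) else \<infinity>)"

end

theory Submission
  imports Defs "HOL-Library.Transitive_Closure_Table"
begin

text \<open>
  Everything reduces to one combinatorial identity. For vertices \<open>u\<close> and \<open>z\<close> let \<open>F u z\<close>
  (\<open>pair_weight\<close>) be the total weight of the two-component forests whose floating component
  contains both \<open>u\<close> and \<open>z\<close>, and let \<open>T\<close> (\<open>tree_weight\<close>) be the total weight of the spanning
  trees. Then \<open>F\<close> is \<open>T\<close> times Green's function. Indeed, in \<open>c {u, w} * (F u z - F w z)\<close> only
  forests separating \<open>u\<close> from \<open>w\<close> survive, and adding the edge \<open>{u, w}\<close> turns these into the
  spanning trees containing that edge (\<open>insert_bridge_bij\<close>). What a tree contributes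
  (\<open>edge_current\<close>) is the unit flow along its path from \<open>z\<close> to \<open>b\<close>: \<open>1\<close> if the path crosses from
  \<open>u\<close> to \<open>w\<close>, \<open>-1\<close> if it crosses from \<open>w\<close> to \<open>u\<close>, and \<open>0\<close> otherwise. The net flow out of
  \<open>u \<noteq> b\<close> is \<open>1\<close> if \<open>u = z\<close> and \<open>0\<close> otherwise (\<open>tree_flow\<close>), so the Laplacian of \<open>F (-) z\<close>
  on \<open>V - {b}\<close> is \<open>T\<close> times the unit mass at \<open>z\<close> (\<open>laplacian_pair_weight\<close>). As both \<open>F\<close> and
  the Laplacian matrix are symmetric, \<open>F / T\<close> is a two-sided inverse (\<open>green_eq\<close>). The
  conditional expectation of the size of the floating component is the sum over \<open>v\<close> of
  \<open>F v z / F z z\<close>, by linearity, and \<open>T\<close> cancels.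

  For the exit time, the row sums \<open>g v = (\<Sum>w\<in>V. G v w)\<close> solve \<open>laplacian E c g = 1\<close> off \<open>b\<close>, that
  is, \<open>g\<close> exceeds its average over one step of the walk by exactly the mean holding time. Summing
  this along the walk killed at \<open>b\<close> telescopes (\<open>occupation_sums\<close>): the expected time spent
  before the \<open>n\<close>-th jump is \<open>g z\<close> minus the expectation of \<open>g\<close> after \<open>n\<close> jumps. The bound
  \<open>g z\<close> on these expected times makes the remainder vanish, and it also forces \<open>b\<close> to be reached
  almost surely (\<open>expected_exit_time\<close>). Symmetry of \<open>G\<close> turns the row sum into the column sum of
  the theorem.
\<close>

section \<open>Reachability, cycles and bridges\<close>

definition reach :: "'a set set \<Rightarrow> 'a \<Rightarrow> 'a \<Rightarrow> bool" where
  "reach B = (\<lambda>x y. {x, y} \<in> B)\<^sup>*\<^sup>*"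

lemma reach_refl [simp]: "reach B x x"
  by (simp add: reach_def)

lemma reach_edge: "{x, y} \<in> B \<Longrightarrow> reach B x y"
  by (auto simp: reach_def)

lemma reach_trans: "reach B x y \<Longrightarrow> reach B y z \<Longrightarrow> reach B x z"
  by (auto simp: reach_def)

lemma reach_sym: "reach B x y \<Longrightarrow> reach B y x"
proof -
  have "symp (\<lambda>x y. {x, y} \<in> B)" by (auto simp: symp_def insert_commute)
  then have "symp ((\<lambda>x y. {x, y} \<in> B)\<^sup>*\<^sup>*)" by (rule symp_rtranclp)
  then show "reach B x y \<Longrightarrow> reach B y x" by (auto simp: reach_def dest: sympD)
qed

lemma reach_mono: "reach B x y \<Longrightarrow> B \<subseteq> B' \<Longrightarrow> reach B' x y"
  unfolding reach_def
  by (rule rev_predicate2D[of "(\<lambda>x y. {x, y} \<in> B)\<^sup>*\<^sup>*"], assumption, rule rtranclp_mono) blast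

lemma reach_induct [consumes 1, case_names refl step]:
  assumes "reach B x y" "P x"
    "\<And>y z. reach B x y \<Longrightarrow> {y, z} \<in> B \<Longrightarrow> P y \<Longrightarrow> P z"
  shows "P y"
  using assms(1) unfolding reach_def
proof (induction rule: rtranclp_induct)
  case base
  show ?case by (rule assms(2))
next
  case (step y z)
  then show ?case by (intro assms(3)[unfolded reach_def, of y z])
qed

text \<open>Every use of the new edge can be bypassed along the walk that already joins its ends.\<close>

lemma reach_insert_redundant:
  assumes "reach B u w" "reach (insert {u, w} B) x y"
  shows "reach B x y"
  using assms(2)
proof (induction rule: reach_induct)
  case (step y z)
  have "reach B y z"
    using step(2) assms(1) reach_edge[of y z B] reach_sym[OF assms(1)]
    by (auto simp: doubleton_eq_iff)
  then show ?case using step(3) reach_trans by metis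
qed simp

lemma graph_component_eq_iff:
  assumes "u \<in> V" "v \<in> V"
  shows "graph_component V B u = graph_component V B v \<longleftrightarrow> reach B u v"
proof
  assume "graph_component V B u = graph_component V B v"
  then have "v \<in> graph_component V B u"
    using assms by (auto simp: graph_component_def)
  then show "reach B u v" by (auto simp: graph_component_def reach_def)
next
  assume "reach B u v"
  then show "graph_component V B u = graph_component V B v"
    unfolding graph_component_def reach_def[symmetric]
    using reach_trans[of B u v] reach_trans[of B v u] reach_sym[of B u v] by blast
qed

lemma connected_graph_iff:
  assumes "V \<noteq> {}"
  shows "connected_graph V B \<longleftrightarrow> (\<forall>u\<in>V. \<forall>v\<in>V. reach B u v)"
proof
  assume "connected_graph V B"
  then obtain C where "graph_components V B = {C}"
    by (auto simp: connected_graph_def card_1_singleton_iff)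
  then have "graph_component V B u = C" if "u \<in> V" for u
    using that by (auto simp: graph_components_def)
  then show "\<forall>u\<in>V. \<forall>v\<in>V. reach B u v" by (metis graph_component_eq_iff)
next
  assume *: "\<forall>u\<in>V. \<forall>v\<in>V. reach B u v"
  obtain u where u: "u \<in> V" using assms by auto
  have "graph_components V B = {graph_component V B u}"
  proof -
    have "graph_component V B v = graph_component V B u" if "v \<in> V" for v
      using that u * by (simp add: graph_component_eq_iff)
    then show ?thesis using u unfolding graph_components_def by blast
  qed
  then show "connected_graph V B" by (simp add: connected_graph_def)
qed

lemma two_componentsI:
  assumes "u \<in> V" "w \<in> V" "\<not> reach B u w" "\<forall>x\<in>V. reach B u x \<or> reach B w x"
  shows "card (graph_components V B) = 2"
proof -
  have "graph_components V B = {graph_component V B u, graph_component V B w}"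
  proof -
    have "graph_component V B x = graph_component V B u \<or> graph_component V B x = graph_component V B w"
      if "x \<in> V" for x
      using that assms by (metis graph_component_eq_iff)
    then show ?thesis using assms(1,2) unfolding graph_components_def by blast
  qed
  moreover have "graph_component V B u \<noteq> graph_component V B w"
    using assms by (simp add: graph_component_eq_iff)
  ultimately show ?thesis by simp
qed

lemma two_components_reach:
  assumes "card (graph_components V B) = 2" "u \<in> V" "v \<in> V" "w \<in> V"
    and "\<not> reach B u v" "\<not> reach B u w"
  shows "reach B v w"
proof -
  obtain C D where CD: "graph_components V B = {C, D}"
    using assms(1) by (meson card_2_iff)
  have mem: "graph_component V B x \<in> {C, D}" if "x \<in> V" for x
    unfolding CD[symmetric] graph_components_def using that by (rule imageI)
  have "graph_component V B v = graph_component V B w"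
    using mem[OF assms(2)] mem[OF assms(3)] mem[OF assms(4)] assms(5,6)
    unfolding graph_component_eq_iff[OF assms(2,3), symmetric]
      graph_component_eq_iff[OF assms(2,4), symmetric] by auto
  then show ?thesis using assms(3,4) by (simp add: graph_component_eq_iff)
qed

lemma two_components_separated:
  assumes "card (graph_components V B) = 2" "b \<in> V"
  obtains x where "x \<in> V" "\<not> reach B b x"
proof -
  have "\<exists>x\<in>V. \<not> reach B b x"
  proof (rule ccontr)
    assume "\<not> ?thesis"
    then have "graph_component V B v = graph_component V B b" if "v \<in> V" for v
      using that assms(2) graph_component_eq_iff[of b V v B] by auto
    then have "graph_components V B = {graph_component V B b}"
      using assms(2) unfolding graph_components_def by blast
    then show False using assms(1) by simp
  qed
  then show thesis using that by blast
qed

lemma floating_eq: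
  assumes B: "card (graph_components V B) = 2" and b: "b \<in> V"
  shows "floating V b B = {v \<in> V. \<not> reach B b v}"
proof -
  obtain x where x: "x \<in> V" "\<not> reach B b x" using two_components_separated[OF assms] .
  have comp: "graph_component V B v = {w \<in> V. reach B v w}" for v
    by (simp add: graph_component_def reach_def)
  have eq: "graph_component V B v = {v \<in> V. \<not> reach B b v}" if v: "v \<in> V" "\<not> reach B b v" for v
  proof -
    have "reach B v w \<longleftrightarrow> \<not> reach B b w" if "w \<in> V" for w
      using two_components_reach[OF B b v(1) that v(2)] reach_trans[of B b w v] reach_sym[of B v w] v(2)
      by blast
    then show ?thesis unfolding comp by blast
  qed
  show ?thesis unfolding floating_def
  proof (rule the_equality)
    show "{v \<in> V. \<not> reach B b v} \<in> graph_components V B \<and> b \<notin> {v \<in> V. \<not> reach B b v}"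
      using eq[OF x] x(1) by (auto simp: graph_components_def)
  next
    fix C assume C: "C \<in> graph_components V B \<and> b \<notin> C"
    then obtain v where v: "v \<in> V" "C = graph_component V B v"
      by (auto simp: graph_components_def)
    then have "\<not> reach B b v" using C b reach_sym[of B b v] by (auto simp: comp)
    then show "C = {v \<in> V. \<not> reach B b v}" using eq v by simp
  qed
qed

text \<open>A walk joining the ends of the edge in its complement can be shortened to one without repeated
  vertices; together with the edge it would be a cycle.\<close>

lemma acyclic_bridge:
  assumes "\<nexists>xs. is_cycle B xs" "{u, w} \<in> B" "u \<noteq> w"
  shows "\<not> reach (B - {{u, w}}) u w"
proof
  let ?r = "\<lambda>x y. {x, y} \<in> B - {{u, w}}"
  assume "reach (B - {{u, w}}) u w"
  then obtain xs0 where "rtrancl_path ?r u xs0 w"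
    by (auto simp: reach_def rtranclp_eq_rtrancl_path)
  then obtain xs where xs: "rtrancl_path ?r u xs w" "distinct (u # xs)"
    by (rule rtrancl_path_distinct)
  have ne: "xs \<noteq> []" using xs(1) assms(3) by (auto elim: rtrancl_path.cases)
  have last: "last xs = w" using rtrancl_path_last[OF xs(1) ne] .
  have nth: "{(u # xs) ! i, xs ! i} \<in> B - {{u, w}}" if "i < length xs" for i
    using rtrancl_path_nth[OF xs(1) that] .
  have "length xs \<noteq> 1"
  proof
    assume "length xs = 1"
    then have "xs = [w]" using last by (cases xs) auto
    then show False using nth[of 0] by simp
  qed
  with ne have len: "2 \<le> length xs" by (cases xs; cases "tl xs") auto
  have "{(u # xs) ! i, (u # xs) ! (Suc i mod length (u # xs))} \<in> B" if "i < length (u # xs)" for i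
  proof (cases "i = length xs")
    case True
    then have "(u # xs) ! i = w" using last ne by (simp add: last_conv_nth nth_Cons')
    then show ?thesis using True assms(2) by (simp add: insert_commute)
  next
    case False
    then show ?thesis using that nth[of i] by simp
  qed
  then have "is_cycle B (u # xs)" using len xs(2) by (simp add: is_cycle_def)
  then show False using assms(1) by blast
qed

text \<open>Going once around the cycle the other way avoids the edge, because the vertices of a cycle are
  distinct and there are at least three of them. So deleting an edge of a cycle does not
  disconnect anything.\<close>

lemma cycle_edge_redundant:
  assumes cyc: "is_cycle B xs" and i: "i < length xs"
  shows "reach (B - {{xs ! i, xs ! (Suc i mod length xs)}}) (xs ! (Suc i mod length xs)) (xs ! i)"
proof -
  let ?n = "length xs"
  let ?e = "\<lambda>j. {xs ! j, xs ! (Suc j mod ?n)}"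
  have n: "3 \<le> ?n" and d: "distinct xs" and E: "\<And>j. j < ?n \<Longrightarrow> ?e j \<in> B"
    using cyc by (auto simp: is_cycle_def)
  have inj: "?e j \<noteq> ?e i" if "j < ?n" "j \<noteq> i" for j
  proof
    assume "?e j = ?e i"
    moreover have "xs ! j \<noteq> xs ! i" using that i d by (simp add: nth_eq_iff_index_eq)
    ultimately have eq: "xs ! j = xs ! (Suc i mod ?n)" "xs ! i = xs ! (Suc j mod ?n)"
      by (auto simp: doubleton_eq_iff)
    have lt: "Suc k mod ?n < ?n" for k using i by (intro mod_less_divisor) linarith
    have j: "j = Suc i mod ?n" using eq(1) nth_eq_iff_index_eq[OF d that(1) lt] by (rule iffD1[rotated])
    have i': "i = Suc j mod ?n" using eq(2) nth_eq_iff_index_eq[OF d i lt] by (rule iffD1[rotated])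
    have m: "Suc k mod ?n = 0 \<and> Suc k = ?n \<or> Suc k mod ?n = Suc k" if "k < ?n" for k
      using that by (cases "Suc k = ?n") simp_all
    show False using m[OF i, folded j] m[OF that(1), folded i'] n by linarith
  qed
  have "reach (B - {?e i}) (xs ! (Suc i mod ?n)) (xs ! ((Suc i + k) mod ?n))" if "k < ?n" for k
    using that
  proof (induction k)
    case (Suc k)
    let ?j = "(Suc i + k) mod ?n"
    have "?j \<noteq> i"
    proof
      assume "?j = i"
      then have "(i + Suc k) mod ?n = i mod ?n" using i by simp
      then have "?n dvd (i + Suc k) - i" by (subst mod_eq_dvd_iff_nat[symmetric]) simp_all
      then show False using Suc.prems by (auto dest: dvd_imp_le)
    qed
    moreover have "?j < ?n" using n by (intro mod_less_divisor) auto
    ultimately have "?e ?j \<in> B - {?e i}" using E inj by blast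
    moreover have "Suc ?j mod ?n = (Suc i + Suc k) mod ?n" by (simp add: mod_Suc_eq)
    ultimately have "reach (B - {?e i}) (xs ! ?j) (xs ! ((Suc i + Suc k) mod ?n))"
      by (intro reach_edge) simp
    then show ?case using reach_trans[OF Suc.IH] Suc.prems by simp
  qed simp
  from this[of "?n - 1"] have "reach (B - {?e i}) (xs ! (Suc i mod ?n)) (xs ! ((Suc i + (?n - 1)) mod ?n))"
    using n by linarith
  moreover have "Suc i + (?n - 1) = i + ?n" using n by linarith
  ultimately show ?thesis using i by simp
qed

text \<open>A new cycle would have to use the new edge, and the rest of it would join \<open>u\<close> to \<open>w\<close> inside
  \<open>B\<close>.\<close>

lemma acyclic_insert:
  assumes "\<nexists>xs. is_cycle B xs" "\<not> reach B u w"
  shows "\<nexists>xs. is_cycle (insert {u, w} B) xs"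
proof
  assume "\<exists>xs. is_cycle (insert {u, w} B) xs"
  then obtain xs where xs: "is_cycle (insert {u, w} B) xs" by blast
  have "\<not> is_cycle B xs" using assms by blast
  then obtain i where i: "i < length xs" "{xs ! i, xs ! (Suc i mod length xs)} = {u, w}"
    using xs unfolding is_cycle_def by (metis insertE)
  have "reach B (xs ! (Suc i mod length xs)) (xs ! i)"
    using reach_mono[OF cycle_edge_redundant[OF xs i(1)], of B] i(2) by blast
  then show False using i(2) assms(2) reach_sym[of B w u] by (auto simp: doubleton_eq_iff)
qed

lemma acyclic_subset: "\<nexists>xs. is_cycle B xs \<Longrightarrow> A \<subseteq> B \<Longrightarrow> \<nexists>xs. is_cycle A xs"
  unfolding is_cycle_def by blast

section \<open>Spanning trees\<close>

definition spanning_trees :: "'a set \<Rightarrow> 'a set set \<Rightarrow> 'a set set set" where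
  "spanning_trees V E = {B. B \<subseteq> E \<and> (\<nexists>xs. is_cycle B xs) \<and> connected_graph V B}"

text \<open>A connected spanning subgraph with the least number of edges has no cycle, since an edge of a
  cycle could be dropped.\<close>

lemma spanning_tree_exists:
  assumes "finite E" "V \<noteq> {}" "connected_graph V E"
  shows "spanning_trees V E \<noteq> {}"
proof -
  let ?P = "\<lambda>B. B \<subseteq> E \<and> connected_graph V B"
  define B where "B = (ARG_MIN card B. ?P B)"
  have B: "?P B" unfolding B_def by (rule arg_min_natI[of ?P E]) (use assms in simp)
  have min: "card B \<le> card B'" if "?P B'" for B'
    unfolding B_def using arg_min_nat_le[of ?P B' card] that by blast
  have "\<not> is_cycle B xs" for xs
  proof
    assume cyc: "is_cycle B xs"
    let ?e = "{xs ! 0, xs ! (Suc 0 mod length xs)}"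
    have len: "0 < length xs" using cyc unfolding is_cycle_def by linarith
    have "\<forall>i<length xs. {xs ! i, xs ! (Suc i mod length xs)} \<in> B"
      using cyc unfolding is_cycle_def by (elim conjE)
    then have e: "?e \<in> B" using len by (elim allE[of _ 0] mp)
    have "reach (B - {?e}) (xs ! 0) (xs ! (Suc 0 mod length xs))"
      by (rule reach_sym) (rule cycle_edge_redundant[OF cyc len])
    note reach_insert_redundant[OF this]
    moreover have "insert ?e (B - {?e}) = B" using e by blast
    ultimately have "connected_graph V (B - {?e})"
      using B assms(2) by (simp add: connected_graph_iff)
    then have "card B \<le> card (B - {?e})" using B by (intro min) auto
    moreover have "card (B - {?e}) < card B"
      using e B assms(1) by (intro card_Diff1_less) (auto intro: finite_subset)
    ultimately show False by simp
  qed
  then show ?thesis using B by (auto simp: spanning_trees_def)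
qed

lemma tree_sides:
  assumes "reach T u x" "{u, w} \<in> T"
  shows "reach (T - {{u, w}}) u x \<or> reach (T - {{u, w}}) w x"
  using assms(1)
proof (induction rule: reach_induct)
  case (step y z)
  show ?case
  proof (cases "{y, z} = {u, w}")
    case True
    then show ?thesis by (auto simp: doubleton_eq_iff)
  next
    case False
    then have "reach (T - {{u, w}}) y z" using step by (intro reach_edge) auto
    then show ?thesis using step reach_trans by metis
  qed
qed simp

text \<open>Induction along a walk from \<open>u\<close> to \<open>x\<close>: whenever the walk returns to \<open>u\<close>, it starts afresh with
  its next vertex as \<open>w\<close>.\<close>

lemma tree_first_step_exists:
  assumes "reach T u x"
  shows "x = u \<or> (\<exists>w. {u, w} \<in> T \<and> reach (T - {{u, w}}) w x)"
  using assms
proof (induction rule: reach_induct)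
  case (step y z)
  show ?case
  proof (cases "y = u \<or> z = u")
    case True
    then show ?thesis using step(2) by auto
  next
    case False
    then obtain w where w: "{u, w} \<in> T" "reach (T - {{u, w}}) w y" using step by auto
    have "reach (T - {{u, w}}) y z" using False step(2)
      by (intro reach_edge) (auto simp: doubleton_eq_iff)
    then show ?thesis using w reach_trans by metis
  qed
qed simp

text \<open>A walk from \<open>w\<close> that avoids the bridge \<open>{u, w}\<close> never visits \<open>u\<close>, hence it avoids
  \<open>{u, w'}\<close> as well. Two different first steps would therefore join \<open>u\<close> to \<open>w'\<close> without using the
  bridge \<open>{u, w'}\<close>.\<close>

lemma tree_first_step_unique:
  assumes ac: "\<nexists>xs. is_cycle T xs"
    and w: "{u, w} \<in> T" "u \<noteq> w" "reach (T - {{u, w}}) w x"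
    and w': "{u, w'} \<in> T" "u \<noteq> w'" "reach (T - {{u, w'}}) w' x"
  shows "w = w'"
proof (rule ccontr)
  assume ne: "w \<noteq> w'"
  have nu: "\<not> reach (T - {{u, w}}) w u"
    using acyclic_bridge[OF ac w(1,2)] reach_sym by metis
  from w(3) have "reach (T - {{u, w'}}) w x"
  proof (induction rule: reach_induct)
    case (step y z)
    have "reach (T - {{u, w}}) w z" using step(1,2) reach_edge reach_trans by metis
    then have "y \<noteq> u" "z \<noteq> u" using nu step(1) by auto
    then have "reach (T - {{u, w'}}) y z" using step(2)
      by (intro reach_edge) (auto simp: doubleton_eq_iff)
    then show ?case using step reach_trans by metis
  qed simp
  moreover have "reach (T - {{u, w'}}) u w"
    using w ne by (intro reach_edge) (auto simp: doubleton_eq_iff)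
  ultimately have "reach (T - {{u, w'}}) u w'"
    using reach_trans[OF reach_trans reach_sym[OF w'(3)]] by blast
  then show False using acyclic_bridge[OF ac w'(1,2)] by blast
qed

section \<open>Weighted forests and the tree current\<close>

locale grounded_network =
  fixes V :: "'a set" and E :: "'a set set" and c :: "'a set \<Rightarrow> real" and b :: 'a
  assumes simple: "simple_graph V E" and conn: "connected_graph V E"
    and c_pos: "\<And>e. e \<in> E \<Longrightarrow> 0 < c e" and b_in: "b \<in> V"
begin

lemma finite_V: "finite V"
  using simple by (simp add: simple_graph_def)

lemma edge_subset: "e \<in> E \<Longrightarrow> e \<subseteq> V"
  using simple by (simp add: simple_graph_def)

lemma finite_E: "finite E"
  using edge_subset finite_V by (intro finite_subset[of E "Pow V"]) auto

lemma no_loop: "{u, w} \<in> E \<Longrightarrow> u \<noteq> w"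
  using simple by (cases "u = w") (auto simp: simple_graph_def)

lemma neighbors_subset: "neighbors E u \<subseteq> V"
  using edge_subset by (auto simp: neighbors_def)

lemma finite_neighbors: "finite (neighbors E u)"
  using neighbors_subset finite_V by (rule finite_subset)

lemma finite_two_forests: "finite (two_forests V E)"
  by (rule finite_subset[of _ "Pow E"]) (use finite_E in \<open>auto simp: two_forests_def\<close>)

lemma finite_spanning_trees: "finite (spanning_trees V E)"
  by (rule finite_subset[of _ "Pow E"]) (use finite_E in \<open>auto simp: spanning_trees_def\<close>)

lemma weight_pos: "B \<subseteq> E \<Longrightarrow> 0 < weight c B"
  unfolding weight_def by (intro prod_pos) (auto intro: c_pos)

lemma weight_pos_two_forest: "B \<in> two_forests V E \<Longrightarrow> 0 < weight c B"
  by (intro weight_pos) (simp add: two_forests_def)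

definition tree_weight :: real where
  "tree_weight = (\<Sum>T\<in>spanning_trees V E. weight c T)"

text \<open>For \<open>u\<close> and \<open>v\<close> in \<open>V\<close>, being in the floating component means not being reachable from \<open>b\<close>.\<close>

definition pair_weight :: "'a \<Rightarrow> 'a \<Rightarrow> real" where
  "pair_weight u v =
     (\<Sum>B\<in>two_forests V E. weight c B * (of_bool (\<not> reach B b u) * of_bool (\<not> reach B b v)))"

lemma tree_weight_pos: "0 < tree_weight"
  unfolding tree_weight_def
proof (rule sum_pos)
  show "spanning_trees V E \<noteq> {}" using spanning_tree_exists[OF finite_E _ conn] b_in by blast
  show "0 < weight c T" if "T \<in> spanning_trees V E" for T
    using that by (intro weight_pos) (simp add: spanning_trees_def)
qed (rule finite_spanning_trees)

lemma pair_weight_nonneg: "0 \<le> pair_weight u v"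
  unfolding pair_weight_def
  by (intro sum_nonneg mult_nonneg_nonneg less_imp_le[OF weight_pos_two_forest]) simp_all

lemma pair_weight_commute: "pair_weight u v = pair_weight v u"
  unfolding pair_weight_def by (simp add: mult.commute)

lemma pair_weight_root [simp]: "pair_weight b v = 0" "pair_weight v b = 0"
  unfolding pair_weight_def by simp_all

lemma pair_weight_le: "pair_weight u v \<le> pair_weight v v"
  unfolding pair_weight_def
  by (intro sum_mono mult_left_mono less_imp_le[OF weight_pos_two_forest]) simp_all

lemma insert_bridge_bij:
  assumes uw: "{u, w} \<in> E"
  shows "bij_betw (insert {u, w}) {B \<in> two_forests V E. \<not> reach B u w}
           {T \<in> spanning_trees V E. {u, w} \<in> T}"
proof (rule bij_betwI[where g = "\<lambda>T. T - {{u, w}}"])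
  have V: "u \<in> V" "w \<in> V" "V \<noteq> {}" using edge_subset[OF uw] by auto
  show "insert {u, w} \<in> {B \<in> two_forests V E. \<not> reach B u w} \<rightarrow> {T \<in> spanning_trees V E. {u, w} \<in> T}"
  proof
    fix B assume "B \<in> {B \<in> two_forests V E. \<not> reach B u w}"
    then have B: "B \<subseteq> E" "\<nexists>xs. is_cycle B xs" "card (graph_components V B) = 2" "\<not> reach B u w"
      by (simp_all add: two_forests_def)
    have step: "reach (insert {u, w} B) u w" by (intro reach_edge) simp
    have "reach (insert {u, w} B) u x" if "x \<in> V" for x
    proof (cases "reach B u x")
      case True
      then show ?thesis by (rule reach_mono) blast
    next
      case False
      then have "reach B w x" using two_components_reach[OF B(3) V(1,2) that B(4)] by blast
      then have "reach (insert {u, w} B) w x" by (rule reach_mono) blast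
      then show ?thesis by (rule reach_trans[OF step])
    qed
    then have "reach (insert {u, w} B) x y" if "x \<in> V" "y \<in> V" for x y
      using that by (meson reach_sym reach_trans)
    then have "connected_graph V (insert {u, w} B)"
      unfolding connected_graph_iff[OF V(3)] by blast
    then show "insert {u, w} B \<in> {T \<in> spanning_trees V E. {u, w} \<in> T}"
      using B(1) uw acyclic_insert[OF B(2,4)] by (simp add: spanning_trees_def)
  qed
  show "(\<lambda>T. T - {{u, w}}) \<in> {T \<in> spanning_trees V E. {u, w} \<in> T} \<rightarrow> {B \<in> two_forests V E. \<not> reach B u w}"
  proof
    fix T assume "T \<in> {T \<in> spanning_trees V E. {u, w} \<in> T}"
    then have T: "T \<subseteq> E" "\<nexists>xs. is_cycle T xs" "connected_graph V T" "{u, w} \<in> T"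
      by (simp_all add: spanning_trees_def)
    have nr: "\<not> reach (T - {{u, w}}) u w"
      using acyclic_bridge[OF T(2,4) no_loop[OF uw]] .
    have "reach (T - {{u, w}}) u x \<or> reach (T - {{u, w}}) w x" if "x \<in> V" for x
      using T(3) V(1) that by (intro tree_sides T(4)) (simp add: connected_graph_iff[OF V(3)])
    then have "card (graph_components V (T - {{u, w}})) = 2"
      using two_componentsI[OF V(1,2) nr] by blast
    then show "T - {{u, w}} \<in> {B \<in> two_forests V E. \<not> reach B u w}"
      using T(1) acyclic_subset[OF T(2) Diff_subset] nr unfolding two_forests_def by blast
  qed
next
  fix B assume "B \<in> {B \<in> two_forests V E. \<not> reach B u w}"
  then have "{u, w} \<notin> B" using reach_edge[of u w B] by blast
  then show "insert {u, w} B - {{u, w}} = B" by blast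
next
  fix T assume "T \<in> {T \<in> spanning_trees V E. {u, w} \<in> T}"
  then show "insert {u, w} (T - {{u, w}}) = T" by blast
qed

text \<open>For \<open>x \<noteq> u\<close> the path in the tree from \<open>u\<close> to \<open>x\<close> has exactly one first edge, and
  \<open>reach (T - {{u, w}}) w x\<close> says that it is \<open>{u, w}\<close>. The difference of these sums for \<open>x = b\<close>
  and \<open>x = z\<close> is the net flow out of \<open>u\<close> of the path from \<open>z\<close> to \<open>b\<close>.\<close>

lemma tree_flow:
  assumes T: "T \<in> spanning_trees V E" and u: "u \<in> V" and x: "x \<in> V"
  shows "(\<Sum>w | w \<in> neighbors E u \<and> {u, w} \<in> T. of_bool (reach (T - {{u, w}}) w x)) = (of_bool (x \<noteq> u) :: real)"
proof -
  have sub: "T \<subseteq> E" and ac: "\<nexists>xs. is_cycle T xs" and "connected_graph V T"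
    using T by (auto simp: spanning_trees_def)
  then have r: "reach T u x" using u x by (subst (asm) connected_graph_iff) auto
  let ?N = "{w. w \<in> neighbors E u \<and> {u, w} \<in> T}"
  have fin: "finite ?N" using finite_neighbors by simp
  show ?thesis
  proof (cases "x = u")
    case True
    have "\<not> reach (T - {{u, w}}) w u" if "w \<in> ?N" for w
      using acyclic_bridge[OF ac, of u w] that no_loop[of u w] sub reach_sym[of _ w u] by blast
    then show ?thesis using True by (simp add: sum.neutral)
  next
    case False
    then obtain w where w: "{u, w} \<in> T" "reach (T - {{u, w}}) w x"
      using tree_first_step_exists[OF r] by blast
    have "w' = w" if "{u, w'} \<in> T" "reach (T - {{u, w'}}) w' x" for w'
      using tree_first_step_unique[OF ac that(1) _ that(2) w(1) _ w(2)] no_loop sub that(1) w(1) by blast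
    then have "(\<Sum>w'\<in>?N. of_bool (reach (T - {{u, w'}}) w' x)) = (\<Sum>w'\<in>?N. if w' = w then 1 else 0 :: real)"
      using w(2) by (intro sum.cong refl) auto
    also have "\<dots> = 1" using fin w(1) sub by (auto simp: neighbors_def sum.delta)
    finally show ?thesis using False by simp
  qed
qed

text \<open>Forests that do not separate \<open>u\<close> from \<open>w\<close> cancel. In a forest that separates them, each vertex
  lies on exactly one side, so the floating component is the side of \<open>u\<close> or of \<open>w\<close> depending on
  where \<open>b\<close> is. Hence the forest counts \<open>1\<close> if \<open>z\<close> is with \<open>u\<close> and \<open>b\<close> with \<open>w\<close>, \<open>-1\<close> in the
  opposite case, and \<open>0\<close> if \<open>b\<close> and \<open>z\<close> are on the same side.\<close>

lemma edge_current:
  assumes uw: "{u, w} \<in> E" and z: "z \<in> V"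
  shows "c {u, w} * (pair_weight u z - pair_weight w z) =
    (\<Sum>T | T \<in> spanning_trees V E \<and> {u, w} \<in> T.
       weight c T * (of_bool (reach (T - {{u, w}}) w b) - of_bool (reach (T - {{u, w}}) w z)))"
proof -
  let ?S = "{B \<in> two_forests V E. \<not> reach B u w}"
  let ?d = "\<lambda>B. (of_bool (\<not> reach B b u) - of_bool (\<not> reach B b w)) * of_bool (\<not> reach B b z) :: real"
  have V: "u \<in> V" "w \<in> V" using edge_subset[OF uw] by auto
  have "c {u, w} * (pair_weight u z - pair_weight w z) =
      (\<Sum>B\<in>two_forests V E. c {u, w} * weight c B * ?d B)"
    unfolding pair_weight_def sum_subtractf[symmetric] sum_distrib_left
    by (intro sum.cong refl) (simp add: algebra_simps)
  also have "\<dots> = (\<Sum>B\<in>?S. c {u, w} * weight c B * ?d B)"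
  proof (intro sum.mono_neutral_right ballI finite_two_forests)
    fix B assume "B \<in> two_forests V E - ?S"
    then have "reach B u w" by simp
    then have "reach B b u \<longleftrightarrow> reach B b w"
      using reach_trans[of B b u w] reach_trans[of B b w u] reach_sym[of B u w] by blast
    then show "c {u, w} * weight c B * ?d B = 0" by simp
  qed auto
  also have "\<dots> = (\<Sum>B\<in>?S. weight c (insert {u, w} B) *
      (of_bool (reach (insert {u, w} B - {{u, w}}) w b) - of_bool (reach (insert {u, w} B - {{u, w}}) w z)))"
  proof (intro sum.cong refl)
    fix B assume "B \<in> ?S"
    then have B: "B \<subseteq> E" "card (graph_components V B) = 2" and nr: "\<not> reach B u w"
      by (simp_all add: two_forests_def)
    have notin: "{u, w} \<notin> B" using nr reach_edge[of u w B] by blast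
    have "finite B" using B(1) finite_E by (rule finite_subset)
    then have wt: "weight c (insert {u, w} B) = c {u, w} * weight c B"
      using notin by (simp add: weight_def)
    have side: "reach B u x \<longleftrightarrow> \<not> reach B w x" if "x \<in> V" for x
      using two_components_reach[OF B(2) V that nr] nr reach_trans[of B u x w] reach_sym[of B w x] by blast
    have "reach B b z \<longleftrightarrow> (reach B w b \<longleftrightarrow> reach B w z)"
      using side[OF b_in] side[OF z] reach_trans[of B b u z] reach_trans[of B b w z] reach_sym[of B u b]
        reach_sym[of B w b] reach_trans[of B w b z] reach_trans[of B w z b] reach_sym[of B b z] by blast
    moreover have "reach B b u \<longleftrightarrow> \<not> reach B w b" "reach B b w \<longleftrightarrow> reach B w b"
      using side[OF b_in] reach_sym[of B b u] reach_sym[of B u b] reach_sym[of B b w] reach_sym[of B w b]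
      by blast+
    ultimately have "?d B = of_bool (reach B w b) - of_bool (reach B w z)" by auto
    then show "c {u, w} * weight c B * ?d B = weight c (insert {u, w} B) *
      (of_bool (reach (insert {u, w} B - {{u, w}}) w b) - of_bool (reach (insert {u, w} B - {{u, w}}) w z))"
      using wt notin by simp
  qed
  also have "\<dots> = (\<Sum>T | T \<in> spanning_trees V E \<and> {u, w} \<in> T.
       weight c T * (of_bool (reach (T - {{u, w}}) w b) - of_bool (reach (T - {{u, w}}) w z)))"
    by (rule sum.reindex_bij_betw[OF insert_bridge_bij[OF uw]])
  finally show ?thesis .
qed

lemma laplacian_pair_weight:
  assumes u: "u \<in> V" "u \<noteq> b" and z: "z \<in> V"
  shows "laplacian E c (\<lambda>v. pair_weight v z) u = of_bool (u = z) * tree_weight"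
proof -
  let ?f = "\<lambda>T w x. of_bool (reach (T - {{u, w}}) w x) :: real"
  have "laplacian E c (\<lambda>v. pair_weight v z) u =
     (\<Sum>w\<in>neighbors E u. \<Sum>T\<in>spanning_trees V E.
        if {u, w} \<in> T then weight c T * (?f T w b - ?f T w z) else 0)"
    unfolding laplacian_def
  proof (intro sum.cong refl)
    fix w assume "w \<in> neighbors E u"
    then have "{u, w} \<in> E" by (simp add: neighbors_def)
    then show "c {u, w} * (pair_weight u z - pair_weight w z) = (\<Sum>T\<in>spanning_trees V E.
        if {u, w} \<in> T then weight c T * (?f T w b - ?f T w z) else 0)"
      using edge_current[OF _ z] by (simp add: sum.inter_filter finite_spanning_trees)
  qed
  also have "\<dots> = (\<Sum>T\<in>spanning_trees V E. \<Sum>w\<in>neighbors E u.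
        if {u, w} \<in> T then weight c T * (?f T w b - ?f T w z) else 0)"
    by (rule sum.swap)
  also have "\<dots> = (\<Sum>T\<in>spanning_trees V E. weight c T * (of_bool (b \<noteq> u) - of_bool (z \<noteq> u)))"
  proof (intro sum.cong refl)
    fix T assume T: "T \<in> spanning_trees V E"
    have "(\<Sum>w\<in>neighbors E u. if {u, w} \<in> T then weight c T * (?f T w b - ?f T w z) else 0) =
      (\<Sum>w | w \<in> neighbors E u \<and> {u, w} \<in> T. weight c T * (?f T w b - ?f T w z))"
      by (simp add: sum.inter_filter finite_neighbors)
    also have "\<dots> = weight c T * ((\<Sum>w | w \<in> neighbors E u \<and> {u, w} \<in> T. ?f T w b) -
        (\<Sum>w | w \<in> neighbors E u \<and> {u, w} \<in> T. ?f T w z))"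
      by (simp only: sum_distrib_left[symmetric] sum_subtractf)
    finally show "(\<Sum>w\<in>neighbors E u. if {u, w} \<in> T then weight c T * (?f T w b - ?f T w z) else 0) =
      weight c T * (of_bool (b \<noteq> u) - of_bool (z \<noteq> u))"
      unfolding tree_flow[OF T u(1) b_in] tree_flow[OF T u(1) z] .
  qed
  also have "\<dots> = of_bool (u = z) * tree_weight"
    using u(2) unfolding tree_weight_def by (cases "u = z") auto
  finally show ?thesis .
qed

end

section \<open>Green's function as a ratio of forest weights\<close>

lemma inverse_matrix_on_eqI:
  assumes "finite S"
    and AB: "\<And>u v. u \<in> S \<Longrightarrow> v \<in> S \<Longrightarrow> (\<Sum>w\<in>S. A u w * B w v) = of_bool (u = v)"
    and BA: "\<And>u v. u \<in> S \<Longrightarrow> v \<in> S \<Longrightarrow> (\<Sum>w\<in>S. B u w * A w v) = of_bool (u = v)"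
    and B0: "\<And>u v. \<not> (u \<in> S \<and> v \<in> S) \<Longrightarrow> B u v = 0"
  shows "inverse_matrix_on S A = B"
  unfolding inverse_matrix_on_def
proof (rule the_equality)
  show "(\<forall>u\<in>S. \<forall>v\<in>S. (\<Sum>w\<in>S. A u w * B w v) = of_bool (u = v)) \<and>
    (\<forall>u\<in>S. \<forall>v\<in>S. (\<Sum>w\<in>S. B u w * A w v) = of_bool (u = v)) \<and>
    (\<forall>u v. \<not> (u \<in> S \<and> v \<in> S) \<longrightarrow> B u v = 0)"
    using AB BA B0 by blast
next
  fix C
  assume C: "(\<forall>u\<in>S. \<forall>v\<in>S. (\<Sum>w\<in>S. A u w * C w v) = of_bool (u = v)) \<and>
    (\<forall>u\<in>S. \<forall>v\<in>S. (\<Sum>w\<in>S. C u w * A w v) = of_bool (u = v)) \<and>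
    (\<forall>u v. \<not> (u \<in> S \<and> v \<in> S) \<longrightarrow> C u v = 0)"
  have "C u v = B u v" if uv: "u \<in> S" "v \<in> S" for u v
  proof -
    have "C u v = (\<Sum>w\<in>S. C u w * of_bool (w = v))"
      using uv assms(1) by simp
    also have "\<dots> = (\<Sum>w\<in>S. C u w * (\<Sum>x\<in>S. A w x * B x v))"
      using uv by (intro sum.cong refl) (simp add: AB)
    also have "\<dots> = (\<Sum>x\<in>S. (\<Sum>w\<in>S. C u w * A w x) * B x v)"
      unfolding sum_distrib_left sum_distrib_right by (subst sum.swap) (simp add: mult.assoc)
    also have "\<dots> = (\<Sum>x\<in>S. of_bool (u = x) * B x v)"
      using C uv by (intro sum.cong refl) simp
    also have "\<dots> = B u v" using uv assms(1) by simp
    finally show ?thesis .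
  qed
  moreover have "C u v = B u v" if "\<not> (u \<in> S \<and> v \<in> S)" for u v
    using that C B0 by metis
  ultimately show "C = B" by (intro ext) metis
qed

context grounded_network
begin

lemma laplacian_matrix_commute: "laplacian_matrix E c u v = laplacian_matrix E c v u"
proof (cases "u = v")
  case False
  have "laplacian_matrix E c u v = (if {u, v} \<in> E then - c {u, v} else 0)" if "u \<noteq> v" for u v
  proof -
    have "laplacian_matrix E c u v = (\<Sum>w\<in>neighbors E u. if w = v then - c {u, v} else 0)"
      unfolding laplacian_matrix_def laplacian_def using that by (intro sum.cong) auto
    then show ?thesis using finite_neighbors by (simp add: neighbors_def)
  qed
  from this[OF False] this[OF False[symmetric]] show ?thesis by (simp add: insert_commute)
qed simp

lemma laplacian_matrix_mult:
  assumes "u \<in> V" "f b = 0"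
  shows "(\<Sum>v\<in>V - {b}. laplacian_matrix E c u v * f v) = laplacian E c f u"
proof -
  have ind: "(\<Sum>v\<in>V - {b}. indicator {v} x * f v) = f x" if "x \<in> V" for x
  proof -
    have "(\<Sum>v\<in>V - {b}. indicator {v} x * f v) = (\<Sum>v\<in>V - {b}. if v = x then f x else 0)"
      by (intro sum.cong) (auto simp: indicator_def)
    then show ?thesis using that assms(2) finite_V by auto
  qed
  have "(\<Sum>v\<in>V - {b}. laplacian_matrix E c u v * f v) =
      (\<Sum>w\<in>neighbors E u. c {u, w} *
         ((\<Sum>v\<in>V - {b}. indicator {v} u * f v) - (\<Sum>v\<in>V - {b}. indicator {v} w * f v)))"
    unfolding laplacian_matrix_def laplacian_def sum_distrib_right sum_distrib_left sum_subtractf[symmetric]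
    by (subst sum.swap) (intro sum.cong refl, simp add: algebra_simps)
  also have "\<dots> = laplacian E c f u"
    unfolding laplacian_def using neighbors_subset assms(1)
    by (intro sum.cong refl) (simp add: ind subset_iff)
  finally show ?thesis .
qed

text \<open>The Laplacian identity makes \<open>pair_weight / tree_weight\<close> a right inverse; transposing it, by
  symmetry of both matrices, gives the left inverse. For \<open>u = b\<close> or \<open>v = b\<close> both sides are
  \<open>0\<close>.\<close>

lemma green_eq:
  assumes "u \<in> V" "v \<in> V"
  shows "green V E c b u v = pair_weight u v / tree_weight"
proof -
  let ?S = "V - {b}"
  let ?L = "laplacian_matrix E c"
  let ?B = "\<lambda>u v. if u \<in> ?S \<and> v \<in> ?S then pair_weight u v / tree_weight else 0"
  have AB: "(\<Sum>w\<in>?S. ?L u w * ?B w v) = of_bool (u = v)" if "u \<in> ?S" "v \<in> ?S" for u v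
  proof -
    have "(\<Sum>w\<in>?S. ?L u w * ?B w v) = (\<Sum>w\<in>?S. ?L u w * pair_weight w v) / tree_weight"
      unfolding sum_divide_distrib using that by (intro sum.cong refl) simp
    then show ?thesis
      using that tree_weight_pos laplacian_matrix_mult[of u "\<lambda>w. pair_weight w v"] laplacian_pair_weight[of u v]
      by simp
  qed
  have "green V E c b = ?B"
    unfolding green_def
  proof (rule inverse_matrix_on_eqI)
    fix u v assume uv: "u \<in> ?S" "v \<in> ?S"
    have "(\<Sum>w\<in>?S. ?B u w * ?L w v) = (\<Sum>w\<in>?S. ?L v w * ?B w u)"
      by (intro sum.cong refl) (auto simp: pair_weight_commute[of u] laplacian_matrix_commute[of v])
    then show "(\<Sum>w\<in>?S. ?B u w * ?L w v) = of_bool (u = v)" using AB[OF uv(2,1)] by auto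
  qed (use finite_V AB in auto)
  then show ?thesis using assms by auto
qed

text \<open>If the diagonal entry vanished, so would the whole column, contradicting that its Laplacian at
  \<open>z\<close> is the positive number \<open>tree_weight\<close>.\<close>

lemma pair_weight_diag_pos:
  assumes "z \<in> V" "z \<noteq> b"
  shows "0 < pair_weight z z"
proof (rule ccontr)
  assume "\<not> 0 < pair_weight z z"
  then have "pair_weight w z = 0" for w
    using pair_weight_le[of w z] pair_weight_nonneg[of w z] by linarith
  then have "laplacian E c (\<lambda>v. pair_weight v z) z = 0" by (simp add: laplacian_def)
  then show False using laplacian_pair_weight[OF assms assms(1)] tree_weight_pos by simp
qed

lemma floating_two_forest:
  "B \<in> two_forests V E \<Longrightarrow> floating V b B = {v \<in> V. \<not> reach B b v}"
  using floating_eq[of V B b] b_in by (simp add: two_forests_def)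

text \<open>The normalising constant of the forest measure cancels, and \<open>card\<close> is a sum of indicators over
  the vertices.\<close>

lemma cond_floating_size_eq:
  assumes z: "z \<in> V" "z \<noteq> b"
  shows "cond_floating_size V E c b z = (\<Sum>v\<in>V. pair_weight v z / pair_weight z z)"
proof -
  let ?F = "two_forests V E"
  let ?Z = "\<Sum>B\<in>?F. weight c B"
  let ?A = "{B. z \<in> floating V b B}"
  let ?p = "two_forest_pmf V E c"
  note wpos = weight_pos_two_forest
  have "?F \<noteq> {}"
    using pair_weight_diag_pos[OF z] by (auto simp: pair_weight_def)
  then have Z: "0 < ?Z" using finite_two_forests wpos by (intro sum_pos)
  have pmf: "pmf ?p B = (if B \<in> ?F then weight c B / ?Z else 0)" for B
    unfolding two_forest_pmf_def
  proof (rule pmf_embed_pmf)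
    show "0 \<le> (if B \<in> ?F then weight c B / ?Z else 0)" for B
      using wpos Z by (auto intro: less_imp_le)
    have "(\<integral>\<^sup>+B. ennreal (if B \<in> ?F then weight c B / ?Z else 0) \<partial>count_space UNIV) =
        (\<Sum>B\<in>?F. ennreal (if B \<in> ?F then weight c B / ?Z else 0))"
      by (rule nn_integral_count_space'[OF finite_two_forests]) auto
    also have "\<dots> = ennreal (\<Sum>B\<in>?F. weight c B / ?Z)"
      using wpos Z by (subst sum_ennreal[symmetric]) (auto intro!: sum.cong less_imp_le)
    also have "\<dots> = 1" using Z by (simp add: sum_divide_distrib[symmetric])
    finally show "(\<integral>\<^sup>+B. ennreal (if B \<in> ?F then weight c B / ?Z else 0) \<partial>count_space UNIV) = 1" .
  qed
  have setp: "set_pmf ?p = ?F"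
    using Z less_imp_neq[OF wpos] by (auto simp: set_pmf_eq pmf)
  have mem: "z \<in> floating V b B \<longleftrightarrow> \<not> reach B b z" if "B \<in> ?F" for B
    using floating_two_forest[OF that] z by simp
  have meas: "measure_pmf.prob ?p ?A = pair_weight z z / ?Z"
  proof -
    have "measure_pmf.prob ?p ?A = measure_pmf.expectation ?p (indicator ?A)" by simp
    also have "\<dots> = (\<Sum>B\<in>?F. indicator ?A B * pmf ?p B)"
      using setp by (intro integral_measure_pmf_real finite_two_forests) auto
    also have "\<dots> = pair_weight z z / ?Z"
      unfolding pair_weight_def sum_divide_distrib
      by (intro sum.cong refl) (auto simp: pmf mem)
    finally show ?thesis .
  qed
  have ne: "set_pmf ?p \<inter> ?A \<noteq> {}"
  proof
    assume "set_pmf ?p \<inter> ?A = {}"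
    then have "measure_pmf.prob ?p ?A = 0" by (simp add: measure_pmf_zero_iff)
    then show False using meas Z pair_weight_diag_pos[OF z] by simp
  qed
  have card: "real (card (floating V b B)) = (\<Sum>v\<in>V. of_bool (\<not> reach B b v))" if "B \<in> ?F" for B
    using floating_two_forest[OF that] finite_V by (simp add: sum_of_bool_eq Int_def)
  have "cond_floating_size V E c b z =
      (\<Sum>B\<in>?F. real (card (floating V b B)) * pmf (cond_pmf ?p ?A) B)"
    unfolding cond_floating_size_def
    using setp set_cond_pmf[OF ne] by (intro integral_measure_pmf_real finite_two_forests) auto
  also have "\<dots> = (\<Sum>B\<in>?F. \<Sum>v\<in>V.
      weight c B * (of_bool (\<not> reach B b v) * of_bool (\<not> reach B b z)) / pair_weight z z)"
  proof (intro sum.cong refl)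
    fix B assume B: "B \<in> ?F"
    have "pmf (cond_pmf ?p ?A) B = weight c B * of_bool (\<not> reach B b z) / pair_weight z z"
      using B Z mem[OF B] by (simp add: pmf_cond[OF ne] meas pmf)
    then show "real (card (floating V b B)) * pmf (cond_pmf ?p ?A) B = (\<Sum>v\<in>V.
      weight c B * (of_bool (\<not> reach B b v) * of_bool (\<not> reach B b z)) / pair_weight z z)"
      unfolding card[OF B] sum_distrib_right by (auto intro!: sum.cong)
  qed
  also have "\<dots> = (\<Sum>v\<in>V. pair_weight v z / pair_weight z z)"
    unfolding pair_weight_def sum_divide_distrib by (rule sum.swap)
  finally show ?thesis .
qed

end

section \<open>Occupation sums along paths\<close>

lemma sum_PiE_insert:
  assumes "a \<notin> I"
  shows "(\<Sum>g\<in>PiE (insert a I) T. F g) = (\<Sum>g\<in>PiE I T. \<Sum>y\<in>T a. F (g(a := y)))"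
proof -
  have "(\<Sum>g\<in>PiE (insert a I) T. F g) = (\<Sum>p\<in>T a \<times> PiE I T. F ((snd p)(a := fst p)))"
    unfolding PiE_insert_eq
    by (subst sum.reindex[OF inj_combinator[OF assms]]) (simp add: case_prod_beta)
  also have "\<dots> = (\<Sum>y\<in>T a. \<Sum>g\<in>PiE I T. F (g(a := y)))"
    unfolding sum.cartesian_product by (simp add: case_prod_beta)
  also have "\<dots> = (\<Sum>g\<in>PiE I T. \<Sum>y\<in>T a. F (g(a := y)))" by (rule sum.swap)
  finally show ?thesis .
qed

definition path_prob :: "'a set set \<Rightarrow> ('a set \<Rightarrow> real) \<Rightarrow> 'a \<Rightarrow> nat \<Rightarrow> (nat \<Rightarrow> 'a) \<Rightarrow> real" where
  "path_prob E c z n x = of_bool (x 0 = z) * (\<Prod>i<n. step_prob E c (x i) (x (Suc i)))"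

text \<open>This is the expectation of \<open>f\<close> at the position after \<open>n\<close> steps of the chain started at \<open>z\<close>,
  on the event that the chain has stayed in \<open>S\<close>.\<close>

definition path_sum ::
  "'a set set \<Rightarrow> ('a set \<Rightarrow> real) \<Rightarrow> 'a \<Rightarrow> 'a set \<Rightarrow> nat \<Rightarrow> ('a \<Rightarrow> real) \<Rightarrow> real" where
  "path_sum E c z S n f = (\<Sum>x\<in>PiE {..n} (\<lambda>_. S). path_prob E c z n x * f (x n))"

lemma path_sum_0:
  assumes "finite S" "z \<in> S"
  shows "path_sum E c z S 0 f = f z"
proof -
  have "path_sum E c z S 0 f = (\<Sum>x\<in>PiE (insert (0::nat) {}) (\<lambda>_. S). of_bool (x 0 = z) * f (x 0))"
    unfolding path_sum_def path_prob_def by (intro sum.cong) auto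
  also have "\<dots> = (\<Sum>y\<in>S. of_bool (y = z) * f y)"
    by (subst sum_PiE_insert) simp_all
  also have "\<dots> = f z" using assms by simp
  finally show ?thesis .
qed

lemma path_sum_Suc:
  "path_sum E c z S (Suc n) f = path_sum E c z S n (\<lambda>v. \<Sum>w\<in>S. step_prob E c v w * f w)"
proof -
  have prob: "path_prob E c z (Suc n) (g(Suc n := y)) = path_prob E c z n g * step_prob E c (g n) y" for g y
    by (simp add: path_prob_def)
  have "path_sum E c z S (Suc n) f =
      (\<Sum>g\<in>PiE {..n} (\<lambda>_. S). \<Sum>y\<in>S. path_prob E c z (Suc n) (g(Suc n := y)) * f y)"
    unfolding path_sum_def atMost_Suc by (subst sum_PiE_insert) simp_all
  then show ?thesis
    unfolding path_sum_def prob by (simp add: sum_distrib_left mult.assoc)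
qed

lemma path_sum_cong:
  "(\<And>v. v \<in> S \<Longrightarrow> f v = g v) \<Longrightarrow> path_sum E c z S n f = path_sum E c z S n g"
  unfolding path_sum_def by (intro sum.cong refl) auto

lemma path_sum_diff:
  "path_sum E c z S n (\<lambda>v. f v - g v) = path_sum E c z S n f - path_sum E c z S n g"
  unfolding path_sum_def by (simp add: right_diff_distrib sum_subtractf)

lemma path_sum_scale:
  "path_sum E c z S n (\<lambda>v. k * f v) = k * path_sum E c z S n f"
  unfolding path_sum_def by (simp add: sum_distrib_left mult_ac)

lemma step_prob_nonneg:
  assumes "\<And>e. e \<in> E \<Longrightarrow> 0 < c e"
  shows "0 \<le> step_prob E c v w"
  using less_imp_le[OF assms] unfolding step_prob_def total_conductance_def neighbors_def
  by (auto intro!: divide_nonneg_nonneg sum_nonneg)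

lemma path_prob_nonneg:
  assumes "\<And>e. e \<in> E \<Longrightarrow> 0 < c e"
  shows "0 \<le> path_prob E c z n x"
  unfolding path_prob_def by (intro mult_nonneg_nonneg prod_nonneg) (simp_all add: step_prob_nonneg assms)

lemma path_sum_mono:
  assumes "\<And>e. e \<in> E \<Longrightarrow> 0 < c e" and "\<And>v. v \<in> S \<Longrightarrow> f v \<le> g v"
  shows "path_sum E c z S n f \<le> path_sum E c z S n g"
  unfolding path_sum_def
  by (intro sum_mono mult_left_mono assms(2) path_prob_nonneg assms(1)) auto

lemma path_sum_nonneg:
  assumes "\<And>e. e \<in> E \<Longrightarrow> 0 < c e" and "\<And>v. v \<in> S \<Longrightarrow> 0 \<le> f v"
  shows "0 \<le> path_sum E c z S n f"
  using path_sum_mono[of E c S "\<lambda>_. 0" f] assms by (simp add: path_sum_def)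

text \<open>With \<open>l\<close> the rates of the holding times, the hypothesis on \<open>g\<close> says that \<open>1 / l\<close> is the expected
  loss of \<open>g\<close> in one step of the chain killed outside \<open>S\<close>, so partial sums telescope. Being
  bounded by \<open>g z\<close>, the series converges and its terms tend to \<open>0\<close>; as \<open>S\<close> is finite, every
  function is dominated by a multiple of \<open>1 / l\<close>, so \<open>path_sum\<close> of \<open>g\<close> and of \<open>1\<close> tend to
  \<open>0\<close> too.\<close>

lemma occupation_sums:
  assumes pos: "\<And>e. e \<in> E \<Longrightarrow> 0 < c e"
    and S: "finite S" "z \<in> S" and l: "\<And>v. v \<in> S \<Longrightarrow> 0 < l v"
    and g: "\<And>v. v \<in> S \<Longrightarrow> 0 \<le> g v"
    and rec: "\<And>v. v \<in> S \<Longrightarrow> (\<Sum>w\<in>S. step_prob E c v w * g w) = g v - 1 / l v"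
  shows "(\<lambda>n. path_sum E c z S n (\<lambda>v. 1 / l v)) sums g z"
    and "(\<lambda>n. path_sum E c z S n (\<lambda>_. 1)) \<longlonglongrightarrow> 0"
proof -
  let ?a = "\<lambda>n. path_sum E c z S n (\<lambda>v. 1 / l v)"
  have a0: "0 \<le> ?a n" for n using l by (intro path_sum_nonneg pos) (auto intro: less_imp_le)
  have step: "path_sum E c z S (Suc n) g = path_sum E c z S n g - ?a n" for n
    unfolding path_sum_Suc path_sum_diff[symmetric] by (intro path_sum_cong rec)
  have partial: "(\<Sum>i<n. ?a i) = g z - path_sum E c z S n g" for n
    by (induction n) (simp_all add: path_sum_0[OF S] step)
  have "summable ?a"
    using a0 partial path_sum_nonneg[OF pos g]
    by (intro summableI_nonneg_bounded[where x = "g z"]) auto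
  then have lim: "?a \<longlonglongrightarrow> 0" by (rule summable_LIMSEQ_zero)
  have small: "(\<lambda>n. path_sum E c z S n f) \<longlonglongrightarrow> 0" if f: "\<And>v. v \<in> S \<Longrightarrow> 0 \<le> f v" for f
  proof (rule tendsto_sandwich)
    \<comment> \<open>\<open>f \<le> ?K * (1 / l)\<close> on \<open>S\<close>, since each \<open>f v * l v\<close> is one of the summands of \<open>?K\<close>.\<close>
    let ?K = "\<Sum>v\<in>S. f v * l v"
    have "f v \<le> ?K * (1 / l v)" if v: "v \<in> S" for v
    proof -
      have "f v * l v \<le> ?K"
        using S(1) v f less_imp_le[OF l] by (intro member_le_sum) auto
      then show ?thesis using l[OF v] by (simp add: field_simps)
    qed
    then show "\<forall>\<^sub>F n in sequentially. path_sum E c z S n f \<le> ?K * ?a n"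
      unfolding path_sum_scale[symmetric] by (intro always_eventually allI path_sum_mono pos)
    show "\<forall>\<^sub>F n in sequentially. 0 \<le> path_sum E c z S n f"
      by (intro always_eventually allI path_sum_nonneg pos f)
    show "(\<lambda>n. ?K * ?a n) \<longlonglongrightarrow> 0" using tendsto_mult_left[OF lim, of ?K] by simp
  qed simp
  show "(\<lambda>n. path_sum E c z S n (\<lambda>_. 1)) \<longlonglongrightarrow> 0" by (rule small) simp
  have "(\<lambda>n. g z - path_sum E c z S n g) \<longlonglongrightarrow> g z - 0"
    by (intro tendsto_diff tendsto_const small g)
  then show "?a sums g z" unfolding sums_def partial by simp
qed

section \<open>The exit time of the walk\<close>

text \<open>Layer-cake formula: the integral of \<open>H\<close> over \<open>A\<close> is the integral over \<open>t \<ge> 0\<close> of the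
  probability of \<open>A\<close> together with \<open>t < H\<close>.\<close>

lemma nn_integral_exponential_tail:
  assumes M: "prob_space M" and H [measurable]: "H \<in> borel_measurable M" and A [measurable]: "A \<in> sets M"
    and l: "0 < l"
    and tail: "\<And>t. 0 \<le> t \<Longrightarrow> measure M {\<omega> \<in> A. t < H \<omega>} = q * exp (- l * t)"
  shows "(\<integral>\<^sup>+\<omega>. ennreal (H \<omega>) * indicator A \<omega> \<partial>M) = ennreal (q / l)"
proof -
  interpret prob_space M by (rule M)
  interpret pair_sigma_finite M "lborel :: real measure" ..
  have q: "0 \<le> q" using tail[of 0] by (metis measure_nonneg mult_zero_right exp_zero mult.right_neutral order_refl)
  let ?f = "\<lambda>\<omega> t. indicator A \<omega> * indicator {0..} t * indicator {t. t < H \<omega>} t :: ennreal"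
  have "(\<integral>\<^sup>+\<omega>. ennreal (H \<omega>) * indicator A \<omega> \<partial>M) = (\<integral>\<^sup>+\<omega>. \<integral>\<^sup>+t. ?f \<omega> t \<partial>lborel \<partial>M)"
  proof (intro nn_integral_cong)
    fix \<omega>
    have "(\<integral>\<^sup>+t. ?f \<omega> t \<partial>lborel) = (\<integral>\<^sup>+t. indicator A \<omega> * indicator {0..<H \<omega>} t \<partial>lborel)"
      by (intro nn_integral_cong) (auto split: split_indicator)
    also have "\<dots> = indicator A \<omega> * emeasure lborel {0..<H \<omega>}"
      by (simp add: nn_integral_cmult)
    also have "emeasure lborel {0..<H \<omega>} = ennreal (H \<omega>)"
      by (cases "0 \<le> H \<omega>") (auto simp: ennreal_neg)
    finally show "ennreal (H \<omega>) * indicator A \<omega> = (\<integral>\<^sup>+t. ?f \<omega> t \<partial>lborel)"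
      by (simp add: mult.commute)
  qed
  also have "\<dots> = (\<integral>\<^sup>+t. \<integral>\<^sup>+\<omega>. ?f \<omega> t \<partial>M \<partial>lborel)"
    by (rule Fubini'[symmetric]) measurable
  also have "\<dots> = (\<integral>\<^sup>+t. ennreal (q / l) * ennreal (exponential_density l t) \<partial>lborel)"
  proof (intro nn_integral_cong)
    fix t :: real
    show "(\<integral>\<^sup>+\<omega>. ?f \<omega> t \<partial>M) = ennreal (q / l) * ennreal (exponential_density l t)"
    proof (cases "0 \<le> t")
      case True
      have m: "{\<omega> \<in> A. t < H \<omega>} \<in> sets M"
      proof -
        have "{\<omega> \<in> A. t < H \<omega>} = A \<inter> {\<omega> \<in> space M. t < H \<omega>}"
          using sets.sets_into_space[OF A] by auto
        then show ?thesis by simp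
      qed
      have "(\<integral>\<^sup>+\<omega>. ?f \<omega> t \<partial>M) = (\<integral>\<^sup>+\<omega>. indicator {\<omega> \<in> A. t < H \<omega>} \<omega> \<partial>M)"
        using True by (intro nn_integral_cong) (auto split: split_indicator)
      also have "\<dots> = ennreal (q * exp (- l * t))"
        using m tail[OF True] by (simp add: emeasure_eq_measure)
      also have "\<dots> = ennreal (q / l) * ennreal (exponential_density l t)"
        using True l q by (subst ennreal_mult[symmetric]) (auto simp: exponential_density_def mult.commute)
      finally show ?thesis .
    qed (simp add: exponential_density_def)
  qed
  also have "\<dots> = ennreal (q / l) * (\<integral>\<^sup>+t. ennreal (exponential_density l t) \<partial>lborel)"
    by (rule nn_integral_cmult) simp
  also have "(\<integral>\<^sup>+t. ennreal (exponential_density l t) \<partial>lborel) = 1"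
    using prob_space.emeasure_space_1[OF prob_space_exponential_density[OF l]]
    by (simp add: emeasure_density)
  finally show ?thesis by simp
qed

text \<open>The event of staying in \<open>S\<close> splits into the finitely many possible paths. Positivity of the
  holding times is kept inside the events because the law of the walk, taken at \<open>t = 0\<close>, speaks of
  exactly these events.\<close>

lemma nn_integral_paths:
  fixes X :: "nat \<Rightarrow> 'w \<Rightarrow> 'a"
  assumes M: "prob_space M" and X [measurable]: "\<And>n. X n \<in> measurable M (count_space UNIV)"
    and H [measurable]: "\<And>n. H n \<in> borel_measurable M"
    and S: "finite S" and F [measurable]: "F \<in> borel_measurable M"
  shows "(\<integral>\<^sup>+\<omega>. F \<omega> * indicator {\<omega> \<in> space M. \<forall>i\<le>n. X i \<omega> \<in> S \<and> 0 < (H i \<omega> :: real)} \<omega> \<partial>M) =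
    (\<Sum>x\<in>PiE {..n} (\<lambda>_. S). \<integral>\<^sup>+\<omega>. F \<omega> * indicator {\<omega> \<in> space M. \<forall>i\<le>n. X i \<omega> = x i \<and> 0 < H i \<omega>} \<omega> \<partial>M)"
proof -
  let ?P = "PiE {..n} (\<lambda>_. S)"
  let ?A = "\<lambda>x. {\<omega> \<in> space M. \<forall>i\<le>n. X i \<omega> = x i \<and> 0 < H i \<omega>}"
  let ?D = "{\<omega> \<in> space M. \<forall>i\<le>n. X i \<omega> \<in> S \<and> 0 < H i \<omega>}"
  have fin: "finite ?P" using S by (intro finite_PiE) auto
  have meas: "?A x \<in> sets M" for x by measurable
  have "(\<integral>\<^sup>+\<omega>. F \<omega> * indicator ?D \<omega> \<partial>M) = (\<integral>\<^sup>+\<omega>. (\<Sum>x\<in>?P. F \<omega> * indicator (?A x) \<omega>) \<partial>M)"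
  proof (intro nn_integral_cong)
    fix \<omega> assume \<omega>: "\<omega> \<in> space M"
    let ?y = "restrict (\<lambda>i. X i \<omega>) {..n}"
    have "(\<Sum>x\<in>?P. F \<omega> * indicator (?A x) \<omega>) =
        (\<Sum>x\<in>?P. if x = ?y then F \<omega> * indicator (?A ?y) \<omega> else 0)"
    proof (intro sum.cong refl)
      fix x assume x: "x \<in> ?P"
      show "F \<omega> * indicator (?A x) \<omega> = (if x = ?y then F \<omega> * indicator (?A ?y) \<omega> else 0)"
      proof (cases "x = ?y")
        case False
        have "\<omega> \<notin> ?A x"
        proof
          assume "\<omega> \<in> ?A x"
          then have "restrict x {..n} = ?y" by (intro restrict_ext) auto
          then have "x = ?y" using PiE_restrict[OF x] by simp
          then show False using False by simp
        qed
        then show ?thesis using False by simp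
      qed simp
    qed
    also have "\<dots> = (if ?y \<in> ?P then F \<omega> * indicator (?A ?y) \<omega> else 0)"
      using fin by simp
    also have "\<dots> = F \<omega> * indicator ?D \<omega>"
      by (auto simp: indicator_def restrict_PiE_iff)
    finally show "F \<omega> * indicator ?D \<omega> = (\<Sum>x\<in>?P. F \<omega> * indicator (?A x) \<omega>)" by simp
  qed
  also have "\<dots> = (\<Sum>x\<in>?P. \<integral>\<^sup>+\<omega>. F \<omega> * indicator (?A x) \<omega> \<partial>M)"
    using meas by (intro nn_integral_sum) measurable
  finally show ?thesis .
qed

locale conductance_walk_process =
  fixes E :: "'a set set" and c :: "'a set \<Rightarrow> real" and z :: 'a
    and M :: "'w measure" and X :: "nat \<Rightarrow> 'w \<Rightarrow> 'a" and H :: "nat \<Rightarrow> 'w \<Rightarrow> real"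
  assumes walk: "conductance_walk E c z M X H" and c_pos: "\<And>e. e \<in> E \<Longrightarrow> 0 < c e"

sublocale conductance_walk_process \<subseteq> prob_space M
  using walk by (simp add: conductance_walk_def)

context conductance_walk_process
begin

lemma X_measurable [measurable]: "X n \<in> measurable M (count_space UNIV)"
  and H_measurable [measurable]: "H n \<in> borel_measurable M"
  using walk by (simp_all add: conductance_walk_def)

lemma walk_law:
  assumes "\<And>i. i \<le> n \<Longrightarrow> 0 \<le> t i"
  shows "measure M {\<omega> \<in> space M. \<forall>i\<le>n. X i \<omega> = x i \<and> t i < H i \<omega>} =
    path_prob E c z n x * (\<Prod>i\<le>n. exp (- total_conductance E c (x i) * t i))"
  using walk assms unfolding conductance_walk_def path_prob_def by blast

lemma stay_sets: "{\<omega> \<in> space M. \<forall>i\<le>n. X i \<omega> \<in> S \<and> 0 < H i \<omega>} \<in> sets M"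
proof -
  have "{\<omega> \<in> space M. \<forall>i\<le>n. X i \<omega> \<in> S \<and> 0 < H i \<omega>} =
      (\<Inter>i\<in>{..n}. (X i -` S \<inter> space M) \<inter> {\<omega> \<in> space M. 0 < H i \<omega>})"
    by auto
  also have "\<dots> \<in> sets M"
  proof (rule sets.finite_INT)
    show "(X i -` S \<inter> space M) \<inter> {\<omega> \<in> space M. 0 < H i \<omega>} \<in> sets M" for i
    proof (rule sets.Int)
      show "X i -` S \<inter> space M \<in> sets M" by (rule measurable_sets[OF X_measurable]) simp
    qed measurable
  qed simp_all
  finally show ?thesis .
qed

lemma measure_stay:
  assumes "finite S"
  shows "measure M {\<omega> \<in> space M. \<forall>i\<le>n. X i \<omega> \<in> S \<and> 0 < H i \<omega>} = path_sum E c z S n (\<lambda>_. 1)"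
proof -
  let ?D = "{\<omega> \<in> space M. \<forall>i\<le>n. X i \<omega> \<in> S \<and> 0 < H i \<omega>}"
  let ?A = "\<lambda>x. {\<omega> \<in> space M. \<forall>i\<le>n. X i \<omega> = x i \<and> 0 < H i \<omega>}"
  have A: "?A x \<in> sets M" for x by measurable
  have law: "measure M (?A x) = path_prob E c z n x" for x
    using walk_law[of n "\<lambda>_. 0" x] by simp
  have "emeasure M ?D = (\<integral>\<^sup>+\<omega>. 1 * indicator ?D \<omega> \<partial>M)" by (simp only: mult_1 nn_integral_indicator[OF stay_sets])
  also have "\<dots> = (\<Sum>x\<in>PiE {..n} (\<lambda>_. S). \<integral>\<^sup>+\<omega>. 1 * indicator (?A x) \<omega> \<partial>M)"
    by (rule nn_integral_paths[OF prob_space_axioms X_measurable H_measurable assms, where F = "\<lambda>_. 1"]) simp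
  also have "\<dots> = (\<Sum>x\<in>PiE {..n} (\<lambda>_. S). ennreal (path_prob E c z n x))"
    by (simp only: mult_1 nn_integral_indicator[OF A] emeasure_eq_measure law)
  also have "\<dots> = ennreal (path_sum E c z S n (\<lambda>_. 1))"
    unfolding path_sum_def by (subst sum_ennreal) (auto intro: path_prob_nonneg c_pos)
  finally have "ennreal (measure M ?D) = ennreal (path_sum E c z S n (\<lambda>_. 1))"
    by (simp only: emeasure_eq_measure)
  moreover have "0 \<le> path_sum E c z S n (\<lambda>_. 1)" by (rule path_sum_nonneg) (simp_all add: c_pos)
  ultimately show ?thesis by (simp add: ennreal_inj)
qed

lemma expected_holding:
  assumes "finite S" and l: "\<And>v. v \<in> S \<Longrightarrow> 0 < total_conductance E c v"
  shows "(\<integral>\<^sup>+\<omega>. ennreal (H n \<omega>) * indicator {\<omega> \<in> space M. \<forall>i\<le>n. X i \<omega> \<in> S \<and> 0 < H i \<omega>} \<omega> \<partial>M) =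
    ennreal (path_sum E c z S n (\<lambda>v. 1 / total_conductance E c v))"
proof -
  let ?A = "\<lambda>x. {\<omega> \<in> space M. \<forall>i\<le>n. X i \<omega> = x i \<and> 0 < H i \<omega>}"
  let ?l = "total_conductance E c"
  have m: "?A x \<in> sets M" for x by measurable
  have "(\<integral>\<^sup>+\<omega>. ennreal (H n \<omega>) * indicator {\<omega> \<in> space M. \<forall>i\<le>n. X i \<omega> \<in> S \<and> 0 < H i \<omega>} \<omega> \<partial>M) =
      (\<Sum>x\<in>PiE {..n} (\<lambda>_. S). \<integral>\<^sup>+\<omega>. ennreal (H n \<omega>) * indicator (?A x) \<omega> \<partial>M)"
    by (rule nn_integral_paths[OF prob_space_axioms X_measurable H_measurable assms(1)]) simp
  also have "\<dots> = (\<Sum>x\<in>PiE {..n} (\<lambda>_. S). ennreal (path_prob E c z n x * (1 / ?l (x n))))"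
  proof (intro sum.cong refl)
    fix x assume x: "x \<in> PiE {..n} (\<lambda>_. S)"
    have "(\<integral>\<^sup>+\<omega>. ennreal (H n \<omega>) * indicator (?A x) \<omega> \<partial>M) = ennreal (path_prob E c z n x / ?l (x n))"
    proof (rule nn_integral_exponential_tail[OF prob_space_axioms H_measurable m])
      show "0 < ?l (x n)" using x by (intro l) auto
      fix t :: real assume t: "0 \<le> t"
      \<comment> \<open>Only the last holding time gets a positive threshold, so earlier factors of the law are \<open>1\<close>.\<close>
      let ?t = "\<lambda>i. if i = n then t else 0"
      have "{\<omega> \<in> ?A x. t < H n \<omega>} = {\<omega> \<in> space M. \<forall>i\<le>n. X i \<omega> = x i \<and> ?t i < H i \<omega>}"
        using t by (auto split: if_splits intro: le_less_trans)
      moreover have "(\<Prod>i\<le>n. exp (- ?l (x i) * ?t i)) = exp (- ?l (x n) * t)"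
      proof -
        have "(\<Prod>i\<le>n. exp (- ?l (x i) * ?t i)) = (\<Prod>i\<le>n. if i = n then exp (- ?l (x n) * t) else 1)"
          by (intro prod.cong refl) auto
        then show ?thesis by simp
      qed
      ultimately show "measure M {\<omega> \<in> ?A x. t < H n \<omega>} = path_prob E c z n x * exp (- ?l (x n) * t)"
        using walk_law[of n ?t x] t by simp
    qed
    then show "(\<integral>\<^sup>+\<omega>. ennreal (H n \<omega>) * indicator (?A x) \<omega> \<partial>M) = ennreal (path_prob E c z n x * (1 / ?l (x n)))"
      by simp
  qed
  also have "\<dots> = ennreal (path_sum E c z S n (\<lambda>v. 1 / ?l v))"
    unfolding path_sum_def
    by (subst sum_ennreal) (auto intro!: divide_nonneg_pos path_prob_nonneg c_pos l)
  finally show ?thesis .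
qed

text \<open>Almost surely the walk visits only vertices and its holding times are positive, so the exit time
  is the sum over \<open>n\<close> of \<open>H n\<close> restricted to the event that \<open>b\<close> has not been visited up to
  jump \<open>n\<close>. This uses that \<open>b\<close> is reached almost surely: the probability of avoiding it for
  \<open>n\<close> jumps is a \<open>path_sum\<close> that tends to \<open>0\<close>.\<close>

lemma expected_exit_time:
  assumes V: "finite V" "z \<in> V" "z \<noteq> b"
    and stoch: "\<And>v. v \<in> V \<Longrightarrow> (\<Sum>w\<in>V. step_prob E c v w) = 1"
    and l: "\<And>v. v \<in> V \<Longrightarrow> 0 < total_conductance E c v"
    and g: "\<And>v. v \<in> V - {b} \<Longrightarrow> 0 \<le> g v"
    and rec: "\<And>v. v \<in> V - {b} \<Longrightarrow>
      (\<Sum>w\<in>V - {b}. step_prob E c v w * g w) = g v - 1 / total_conductance E c v"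
  shows "(\<integral>\<^sup>+\<omega>. exit_time b X H \<omega> \<partial>M) = ennreal (g z)"
proof -
  let ?S = "V - {b}"
  define D where "D S n = {\<omega> \<in> space M. \<forall>i\<le>n. X i \<omega> \<in> S \<and> 0 < H i \<omega>}" for S n
  have D_meas [measurable]: "D S n \<in> sets M" for S n unfolding D_def by (rule stay_sets)
  have D_prob: "prob (D U n) = path_sum E c z U n (\<lambda>_. 1)" if "finite U" for U n
    unfolding D_def by (rule measure_stay[OF that])
  have D_iff: "\<omega> \<in> D U n \<longleftrightarrow> (\<forall>i\<le>n. X i \<omega> \<in> U \<and> 0 < H i \<omega>)" if "\<omega> \<in> space M" for \<omega> U n
    using that by (simp add: D_def)
  have S: "finite ?S" "z \<in> ?S" using V by auto
  have lS: "0 < total_conductance E c v" if "v \<in> ?S" for v using that l by simp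
  note occ = occupation_sums[OF c_pos S lS g rec]
  have "path_sum E c z V n (\<lambda>_. 1) = 1" for n
  proof (induction n)
    case (Suc n)
    have "path_sum E c z V (Suc n) (\<lambda>_. 1) = path_sum E c z V n (\<lambda>_. 1)"
      unfolding path_sum_Suc by (intro path_sum_cong) (simp add: stoch)
    then show ?case using Suc by simp
  qed (simp add: path_sum_0 V)
  then have "AE \<omega> in M. \<omega> \<in> D V n" for n
    by (intro AE_prob_1) (simp add: D_prob V(1))
  then have inV: "AE \<omega> in M. \<forall>n. X n \<omega> \<in> V \<and> 0 < H n \<omega>"
    unfolding AE_all_countable by (intro allI, rule eventually_mono) (auto simp: D_def)
  have "AE \<omega> in M. \<not> (\<forall>n. \<omega> \<in> D ?S n)"
  proof (rule AE_I)
    show "{\<omega> \<in> space M. \<not> \<not> (\<forall>n. \<omega> \<in> D ?S n)} \<subseteq> (\<Inter>n. D ?S n)" by auto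
    show m: "(\<Inter>n. D ?S n) \<in> sets M" by measurable
    have "prob (\<Inter>n. D ?S n) \<le> path_sum E c z ?S n (\<lambda>_. 1)" for n
      unfolding D_prob[OF S(1), symmetric] by (intro finite_measure_mono D_meas) blast
    then have "prob (\<Inter>n. D ?S n) \<le> 0"
      by (intro LIMSEQ_le_const[OF occ(2)]) auto
    then show "emeasure M (\<Inter>n. D ?S n) = 0"
      using antisym[OF _ measure_nonneg] by (simp add: emeasure_eq_measure)
  qed
  with inV AE_space have eq: "AE \<omega> in M. exit_time b X H \<omega> = (\<Sum>n. ennreal (H n \<omega>) * indicator (D ?S n) \<omega>)"
  proof eventually_elim
    case (elim \<omega>)
    note good = elim(1) and \<omega> = elim(2)
    have ex: "\<exists>n. X n \<omega> = b" using elim D_iff[OF \<omega>] by blast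
    define N where "N = (LEAST n. X n \<omega> = b)"
    have N: "X N \<omega> = b" using LeastI_ex[OF ex] by (simp add: N_def)
    have before: "X i \<omega> \<noteq> b" if "i < N" for i
      using not_less_Least[of i "\<lambda>n. X n \<omega> = b"] that by (simp add: N_def)
    have mem: "\<omega> \<in> D ?S n \<longleftrightarrow> n < N" for n
    proof
      assume "\<omega> \<in> D ?S n"
      then have "\<forall>i\<le>n. X i \<omega> \<noteq> b" by (simp add: D_iff[OF \<omega>])
      then show "n < N" using N not_le by blast
    next
      assume "n < N"
      then show "\<omega> \<in> D ?S n" using good before by (simp add: D_iff[OF \<omega>])
    qed
    have "(\<Sum>n. ennreal (H n \<omega>) * indicator (D ?S n) \<omega>) = (\<Sum>n<N. ennreal (H n \<omega>) * indicator (D ?S n) \<omega>)"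
    proof (rule suminf_finite)
      fix n assume "n \<notin> {..<N}"
      then have "\<omega> \<notin> D ?S n" using mem by simp
      then show "ennreal (H n \<omega>) * indicator (D ?S n) \<omega> = 0" by simp
    qed simp
    also have "\<dots> = (\<Sum>n<N. ennreal (H n \<omega>))"
    proof (intro sum.cong refl)
      fix n assume "n \<in> {..<N}"
      then have "\<omega> \<in> D ?S n" using mem by simp
      then show "ennreal (H n \<omega>) * indicator (D ?S n) \<omega> = ennreal (H n \<omega>)" by simp
    qed
    also have "\<dots> = ennreal (\<Sum>n<N. H n \<omega>)"
      using good by (intro sum_ennreal) (auto intro: less_imp_le)
    also have "\<dots> = exit_time b X H \<omega>"
      using ex by (simp add: exit_time_def N_def)
    finally show "exit_time b X H \<omega> = (\<Sum>n. ennreal (H n \<omega>) * indicator (D ?S n) \<omega>)" by simp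
  qed
  have "(\<integral>\<^sup>+\<omega>. exit_time b X H \<omega> \<partial>M) = (\<integral>\<^sup>+\<omega>. (\<Sum>n. ennreal (H n \<omega>) * indicator (D ?S n) \<omega>) \<partial>M)"
    by (rule nn_integral_cong_AE[OF eq])
  also have "\<dots> = (\<Sum>n. \<integral>\<^sup>+\<omega>. ennreal (H n \<omega>) * indicator (D ?S n) \<omega> \<partial>M)"
    by (intro nn_integral_suminf) measurable
  also have "\<dots> = (\<Sum>n. ennreal (path_sum E c z ?S n (\<lambda>v. 1 / total_conductance E c v)))"
    by (simp only: D_def expected_holding[OF S(1) lS])
  also have "\<dots> = ennreal (g z)"
  proof (rule suminf_ennreal_eq[OF _ occ(1)])
    show "0 \<le> path_sum E c z ?S n (\<lambda>v. 1 / total_conductance E c v)" for n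
      using less_imp_le[OF lS] by (intro path_sum_nonneg c_pos) simp_all
  qed
  finally show ?thesis .
qed

end

section \<open>Floating size and exit time\<close>

context grounded_network
begin

lemma total_conductance_pos:
  assumes v: "v \<in> V" and x: "x \<in> V" "x \<noteq> v"
  shows "0 < total_conductance E c v"
proof -
  have "reach E v x" using conn v x(1) connected_graph_iff[of V E] by blast
  then obtain w where w: "{v, w} \<in> E" using tree_first_step_exists[of E v x] x(2) by blast
  show ?thesis unfolding total_conductance_def
  proof (rule sum_pos[OF finite_neighbors])
    show "neighbors E v \<noteq> {}" using w by (auto simp: neighbors_def)
    show "0 < c {v, y}" if "y \<in> neighbors E v" for y
      using that by (intro c_pos) (simp add: neighbors_def)
  qed
qed

lemma sum_step_prob:
  "(\<Sum>w\<in>V. step_prob E c v w * f w) = (\<Sum>w\<in>neighbors E v. c {v, w} * f w) / total_conductance E c v"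
proof -
  have "(\<Sum>w\<in>V. step_prob E c v w * f w) = (\<Sum>w\<in>neighbors E v. step_prob E c v w * f w)"
    by (rule sum.mono_neutral_right[OF finite_V neighbors_subset]) (simp add: step_prob_def)
  also have "\<dots> = (\<Sum>w\<in>neighbors E v. c {v, w} * f w / total_conductance E c v)"
    by (intro sum.cong refl) (simp add: step_prob_def)
  finally show ?thesis by (simp only: sum_divide_distrib)
qed

text \<open>The normalised Laplacian is the identity minus the transition operator.\<close>

lemma laplacian_conv_step_prob:
  assumes "0 < total_conductance E c v"
  shows "(\<Sum>w\<in>V. step_prob E c v w * f w) = f v - laplacian E c f v / total_conductance E c v"
proof -
  have "laplacian E c f v = total_conductance E c v * f v - (\<Sum>w\<in>neighbors E v. c {v, w} * f w)"
    unfolding laplacian_def total_conductance_def sum_distrib_right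
    by (simp add: right_diff_distrib sum_subtractf)
  then show ?thesis unfolding sum_step_prob using assms by (simp add: field_simps)
qed

text \<open>These are the row sums of Green's function.\<close>

definition occupation :: "'a \<Rightarrow> real" where
  "occupation v = (\<Sum>w\<in>V. pair_weight v w / tree_weight)"

lemma laplacian_occupation:
  assumes v: "v \<in> V" "v \<noteq> b"
  shows "laplacian E c occupation v = 1"
proof -
  have "laplacian E c occupation v =
      (\<Sum>u\<in>neighbors E v. \<Sum>w\<in>V. c {v, u} * (pair_weight v w - pair_weight u w) / tree_weight)"
    unfolding laplacian_def occupation_def sum_subtractf[symmetric] sum_distrib_left
    by (simp only: diff_divide_distrib[symmetric] times_divide_eq_right)
  also have "\<dots> = (\<Sum>w\<in>V. laplacian E c (\<lambda>u. pair_weight u w) v / tree_weight)"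
    unfolding laplacian_def sum_divide_distrib by (rule sum.swap)
  also have "\<dots> = (\<Sum>w\<in>V. of_bool (v = w))"
    using tree_weight_pos by (intro sum.cong refl) (simp add: laplacian_pair_weight v)
  also have "\<dots> = 1" using v(1) finite_V by simp
  finally show ?thesis .
qed

lemma expected_exit_time_occupation:
  fixes M :: "'w measure"
  assumes walk: "conductance_walk E c z M X H" and z: "z \<in> V" "z \<noteq> b"
  shows "(\<integral>\<^sup>+\<omega>. exit_time b X H \<omega> \<partial>M) = ennreal (occupation z)"
proof -
  interpret conductance_walk_process E c z M X H
    by unfold_locales (rule walk, rule c_pos)
  have l: "0 < total_conductance E c v" if "v \<in> V" for v
    using total_conductance_pos[OF that z(1)] total_conductance_pos[OF that b_in] z(2) by metis
  show ?thesis
  proof (rule expected_exit_time[OF finite_V z _ l])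
    show "(\<Sum>w\<in>V. step_prob E c v w) = 1" if "v \<in> V" for v
      using laplacian_conv_step_prob[OF l[OF that], of "\<lambda>_. 1"] by (simp add: laplacian_def)
    show "0 \<le> occupation v" for v
      unfolding occupation_def
      by (intro sum_nonneg divide_nonneg_pos pair_weight_nonneg tree_weight_pos)
    show "(\<Sum>w\<in>V - {b}. step_prob E c v w * occupation w) = occupation v - 1 / total_conductance E c v"
      if v: "v \<in> V - {b}" for v
    proof -
      have "(\<Sum>w\<in>V. step_prob E c v w * occupation w) = (\<Sum>w\<in>V - {b}. step_prob E c v w * occupation w)"
        using finite_V by (intro sum.mono_neutral_right) (auto simp: occupation_def)
      then show ?thesis
        using v laplacian_conv_step_prob[of v occupation] laplacian_occupation[of v] l[of v] by simp
    qed
  qed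
qed

end

theorem mainTheorem6:
  fixes V :: "'a set" and E :: "'a set set" and c :: "'a set \<Rightarrow> real" and b z\<^sub>0 :: 'a
  assumes "simple_graph V E" and "connected_graph V E"
    and "\<forall>e\<in>E. 0 < c e"
    and "b \<in> V" and "z\<^sub>0 \<in> V" and "z\<^sub>0 \<noteq> b"
  defines "G \<equiv> green V E c b"
  shows "cond_floating_size V E c b z\<^sub>0 = (\<Sum>v\<in>V. G v z\<^sub>0 / G z\<^sub>0 z\<^sub>0) \<and>
    (\<forall>(M :: 'w measure) X H. conductance_walk E c z\<^sub>0 M X H \<longrightarrow>
       ennreal (\<Sum>v\<in>V. G v z\<^sub>0 / G z\<^sub>0 z\<^sub>0) =
         (\<integral>\<^sup>+\<omega>. exit_time b X H \<omega> \<partial>M) / ennreal (G z\<^sub>0 z\<^sub>0))"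
proof -
  interpret grounded_network V E c b
    by unfold_locales (use assms in auto)
  note z = assms(5,6)
  have G: "G v z\<^sub>0 = pair_weight v z\<^sub>0 / tree_weight" if "v \<in> V" for v
    unfolding G_def by (rule green_eq[OF that z(1)])
  have G_pos: "0 < G z\<^sub>0 z\<^sub>0"
    using G[OF z(1)] pair_weight_diag_pos[OF z] tree_weight_pos by simp
  have floating_side: "cond_floating_size V E c b z\<^sub>0 = (\<Sum>v\<in>V. G v z\<^sub>0 / G z\<^sub>0 z\<^sub>0)"
    unfolding cond_floating_size_eq[OF z]
    using tree_weight_pos by (intro sum.cong refl) (simp add: G z)
  have "(\<Sum>v\<in>V. G v z\<^sub>0) = occupation z\<^sub>0"
    unfolding occupation_def by (intro sum.cong refl) (simp add: G pair_weight_commute)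
  then have ratio: "(\<Sum>v\<in>V. G v z\<^sub>0 / G z\<^sub>0 z\<^sub>0) = occupation z\<^sub>0 / G z\<^sub>0 z\<^sub>0"
    by (simp add: sum_divide_distrib[symmetric])
  have "0 \<le> occupation z\<^sub>0"
    unfolding occupation_def
    by (intro sum_nonneg divide_nonneg_pos pair_weight_nonneg tree_weight_pos)
  then have "ennreal (\<Sum>v\<in>V. G v z\<^sub>0 / G z\<^sub>0 z\<^sub>0) =
      (\<integral>\<^sup>+\<omega>. exit_time b X H \<omega> \<partial>M) / ennreal (G z\<^sub>0 z\<^sub>0)"
    if "conductance_walk E c z\<^sub>0 M X H" for M :: "'w measure" and X H
    unfolding ratio expected_exit_time_occupation[OF that z] using G_pos by (simp add: divide_ennreal)
  with floating_side show ?thesis by blast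
qed

end
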